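(* Let $g:\mathbb{N}\to(0,\infty)$ be any function with $g(m)\to\infty$ as $m\to\infty$. Then there exist constants $D\in\mathbb{N}$, $a\ge 1$, $b\ge 0$ and sequences $(G_n,o_n)_{n\ge1}$ and $(G'_n,o'_n)_{n\ge 1}$ of finite connected rooted graphs such that: (i) every vertex of every $G_n$ and every $G'_n$ has degree at most $D$, and $|G_n|\to\infty$ as $n\to\infty$; (ii) for every $n$ there is an $(a,b)$ quasi-isometry $\psi_n$ from $G_n$ to $G'_n$ (with respect to the graph distances) with $\psi_n(o_n)=o'_n$; (iii) for every fixed $\epsilon\in(0,1/2)$ and each of the three notions of mixing time $p\in\{\mathrm{TV},2,\infty\}$ (total variation, $\ell^2$, $\ell^\infty$), the mixing time of simple random walk on $G_n$ started at the root is of order $\log|G_n|$: there are constants $0<c\le C<\infty$ (not depending on $n$) such that for all sufficiently large $n$ $$c\log|G_n|\ \le\ t^{(p)}_{mix}(\epsilon;G_n,o_n)\ \le\ C\log|G_n| ;$$ (iv) for every fixed $\epsilon\in(0,1/2)$ and each $p\in\{\mathrm{TV},2,\infty\}$, the ratio of $|G_n|$ over the mixing time of simple random walk on $G'_n$ started at the root tends to infinity, but no faster than $g$: $$\frac{|G_n|}{t^{(p)}_{mix}(\epsilon;G'_n,o'_n)}\longrightarrow\infty\quad (n\to\infty),\qquad\text{and}\qquad \frac{|G_n|}{t^{(p)}_{mix}(\epsilon;G'_n,o'_n)}\le g(|G_n|)\ \text{ for all sufficiently large } n .$$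
   Context: For a finite graph $G$, $|G|$ denotes its number of vertices. Simple random walk on $G$ is the discrete-time Markov chain which at each step moves to a uniformly chosen neighbour of the current vertex; $P^t_x$ denotes its distribution at time $t$ when started at the vertex $x$, and $\pi$ denotes its stationary distribution, $\pi(y)=\deg(y)/\sum_z\deg(z)$. For probability distributions $\mu,\nu$ on the vertex set, the total variation distance is $\|\mu-\nu\|_{TV}=\frac12\sum_y|\mu(y)-\nu(y)|$. Define $$d^{(\mathrm{TV})}_x(t)=\|P^t_x-\pi\|_{TV},\quad d^{(2)}_x(t)=\Big(\sum_y \pi(y)\Big|\frac{P^t_x(y)}{\pi(y)}-1\Big|^2\Big)^{1/2},\quad d^{(\infty)}_x(t)=\max_y\Big|\frac{P^t_x(y)}{\pi(y)}-1\Big| ,$$ and for $p\in\{\mathrm{TV},2,\infty\}$ the $\epsilon$-mixing time of the walk on $G$ started at $x$ is $$t^{(p)}_{mix}(\epsilon;G,x)=\inf\{t\ge 0: d^{(p)}_x(t)<\epsilon\}.$$ A map $\psi:X\to Y$ between metric spaces is an $(a,b)$ quasi-isometry if for all $u,v\in X$ $$a^{-1}d(u,v)-b\le d(\psi(u),\psi(v))\le a\,d(u,v)+b,$$ and for every $y\in Y$ there is $x\in X$ with $d(\psi(x),y)\le a+b$. Graphs are regarded as metric spaces on their vertex sets with the graph distance. *)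

theory Defs
  imports "HOL-Probability.Probability" "Graph_Theory.Graph_Theory"
begin

(* A finite simple graph is a pair_graph of Graph_Theory: finite, loop-free, with a symmetric arc
   relation on the vertex set. An undirected edge is thus a pair of opposite arcs, so that
   out_degree is the degree. The name "connected" is also used in topology, hence its
   qualification. *)
definition finite_connected_rooted_graph :: "'a pair_pre_digraph \<Rightarrow> 'a \<Rightarrow> bool" where
  "finite_connected_rooted_graph G r \<longleftrightarrow>
     pair_graph G \<and> Digraph_Component.connected (with_proj G) \<and> r \<in> pverts G"

definition vertex_degree :: "'a pair_pre_digraph \<Rightarrow> 'a \<Rightarrow> nat" where
  "vertex_degree G x = out_degree (with_proj G) x"

definition graph_dist :: "'a pair_pre_digraph \<Rightarrow> 'a \<Rightarrow> 'a \<Rightarrow> real" where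
  "graph_dist G u v = real_of_ereal (wf_digraph.\<mu> (with_proj G) (\<lambda>_. 1) u v)"

definition quasi_isometry ::
    "real \<Rightarrow> real \<Rightarrow> 'a set \<Rightarrow> ('a \<Rightarrow> 'a \<Rightarrow> real) \<Rightarrow> 'b set \<Rightarrow> ('b \<Rightarrow> 'b \<Rightarrow> real) \<Rightarrow> ('a \<Rightarrow> 'b) \<Rightarrow> bool" where
  "quasi_isometry a b X dX Y dY \<psi> \<longleftrightarrow>
     \<psi> ` X \<subseteq> Y \<and>
     (\<forall>u\<in>X. \<forall>v\<in>X. inverse a * dX u v - b \<le> dY (\<psi> u) (\<psi> v) \<and> dY (\<psi> u) (\<psi> v) \<le> a * dX u v + b) \<and>
     (\<forall>y\<in>Y. \<exists>x\<in>X. dY (\<psi> x) y \<le> a + b)"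

(* The law of the walk at time t. If x is an isolated vertex, i.e. the graph has a single vertex,
   then the step distribution is an unspecified pmf. *)
primrec srw :: "'a pair_pre_digraph \<Rightarrow> 'a \<Rightarrow> nat \<Rightarrow> 'a pmf" where
  "srw G x 0 = return_pmf x"
| "srw G x (Suc t) = bind_pmf (srw G x t) (\<lambda>y. pmf_of_set {z. (y, z) \<in> parcs G})"

definition stationary :: "'a pair_pre_digraph \<Rightarrow> 'a \<Rightarrow> real" where
  "stationary G y = real (vertex_degree G y) / (\<Sum>z\<in>pverts G. real (vertex_degree G z))"

datatype mixing_type = TV | Ell_2 | Ell_infinity

fun mixing_dist :: "mixing_type \<Rightarrow> 'a pair_pre_digraph \<Rightarrow> 'a \<Rightarrow> nat \<Rightarrow> real" where
  "mixing_dist TV G x t =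
     (1/2) * (\<Sum>y\<in>pverts G. \<bar>pmf (srw G x t) y - stationary G y\<bar>)"
| "mixing_dist Ell_2 G x t =
     sqrt (\<Sum>y\<in>pverts G. stationary G y * \<bar>pmf (srw G x t) y / stationary G y - 1\<bar>\<^sup>2)"
| "mixing_dist Ell_infinity G x t =
     Max ((\<lambda>y. \<bar>pmf (srw G x t) y / stationary G y - 1\<bar>) ` pverts G)"

(* Extended-real valued, as the infimum of the empty set is infinity (e.g. on bipartite graphs,
   where the walk is periodic). *)
definition mixing_time :: "mixing_type \<Rightarrow> real \<Rightarrow> 'a pair_pre_digraph \<Rightarrow> 'a \<Rightarrow> ereal" where
  "mixing_time p \<epsilon> G x = (INF t \<in> {t::nat. mixing_dist p G x t < \<epsilon>}. ereal (real t))"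

end

theory Submission
  imports Defs "HOL-Real_Asymp.Real_Asymp"
begin

text \<open>
  A walk on a regular tree is pushed outwards at constant speed. Started at the root of a finite
  tree it reaches the leaves after a time of the order of the height, and its law is then spread
  evenly by symmetry: it has mixed, in the logarithm of the size. Started anywhere deep inside, on
  the contrary, it needs a time of the order of the size of a subtree to leave that subtree. So the
  mixing time from the root depends on the subtree in which the walk gets caught. A bounded local
  change of the edges can move this hitting distribution from the uniform one to one that lives on
  a vanishing proportion of the subtrees, and then mixing has to wait until the walk gets out again.

  Both graphs have the same vertices, pairs of a word over 20 symbols and a word over 2 letters.
  From the root, a binary tree of height \<open>h\<close> writes \<open>h\<close> letters. Along the next
  \<open>h\<close> levels, each outward step exchanges the last letter for an arbitrary symbol. Finally
  each of the \<open>20 ^ h\<close> words of \<open>h\<close> symbols is the root of a 20-ary tree of depth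
  \<open>m\<close>, a trap. In addition every vertex but the root is joined to a twin. In the first
  graph all inward steps from a symbol are possible, to either letter; in the second one a symbol of
  the unfavoured half leads back to one of the two letters only. As the other letter is then reached
  through the twin, the identity is a quasi-isometry.

  The middle part has up to two inward edges per vertex, and not one as in a tree, for the sake of the
  second half of the last claim: in a tree, mixing among the traps takes a time proportional to the
  whole graph, whereas here a walk that leaves a trap may reach the centre, and so forget its trap, at
  a cost of order \<open>15 ^ h * 20 ^ m\<close>, which is much less than the number
  \<open>20 ^ (h + m)\<close> of vertices.

  All functions that matter depend only on a class of vertices: the level in the first graph, the
  level and the sequence of favoured symbols in the second. The classes form an equitable partition
  in which twins are equivalent (\<open>rooted_walk_layers\<close>). The walk is therefore lazy on class
  functions and a Poincare inequality contracts their variance at each step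
  (\<open>variance_contraction\<close>). Poincare inequalities come from positive superharmonic functions
  (\<open>barta\<close>): an exponential of the height in the first graph (\<open>gap_unbiased\<close>), with
  a constant spectral gap, and \<open>barrier\<close> in the second (\<open>gap_biased\<close>), with the gap
  stated above. For the first graph this already gives the logarithmic upper bound in the supremum norm
  (\<open>sup_deviation_from_gap\<close>). For the second, the logarithm of the size that is lost in this
  way is not affordable, as \<open>g\<close> may grow arbitrarily slowly; a bound on Green functions
  (\<open>green_le\<close>) shows that after about \<open>20 ^ m\<close> steps the density is bounded in
  terms of \<open>h\<close> alone, and the gap is used only from then on
  (\<open>sup_deviation_after_smoothing\<close>).

  The lower bounds concern total variation. In the first graph the walk visits few vertices in few
  steps. In the second, \<open>potential\<close> is nearly a supermartingale (\<open>potential_drift\<close>)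
  and equals 1 at the root, but it exceeds 9 in all but a vanishing proportion of the traps;
  so the walk does not find those traps until time \<open>20 ^ m / (23 / 20) ^ h\<close>. Upper and lower
  bound differ from the number of vertices by factors that depend on \<open>h\<close> only. With
  \<open>h = n\<close>, the depth \<open>m\<close> is taken so large that \<open>g\<close> exceeds these factors.
\<close>

section \<open>Averaging over neighbours\<close>

locale finite_walk =
  fixes V :: "'v set" and N :: "'v \<Rightarrow> 'v set"
  assumes finite_V: "finite V"
    and nbr_subset: "x \<in> V \<Longrightarrow> N x \<subseteq> V"
    and nbr_sym: "x \<in> V \<Longrightarrow> y \<in> N x \<Longrightarrow> x \<in> N y"
    and nbr_irrefl: "x \<in> V \<Longrightarrow> x \<notin> N x"
    and nbr_nonempty: "x \<in> V \<Longrightarrow> N x \<noteq> {}"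
begin

definition deg :: "'v \<Rightarrow> real" where "deg x = real (card (N x))"
definition avg :: "('v \<Rightarrow> real) \<Rightarrow> 'v \<Rightarrow> real" where "avg f x = (\<Sum>y\<in>N x. f y) / deg x"
definition ip :: "('v \<Rightarrow> real) \<Rightarrow> ('v \<Rightarrow> real) \<Rightarrow> real" where
  "ip f g = (\<Sum>x\<in>V. deg x * f x * g x)"
definition dirichlet :: "('v \<Rightarrow> real) \<Rightarrow> real" where
  "dirichlet f = (\<Sum>x\<in>V. \<Sum>y\<in>N x. (f x - f y)\<^sup>2)"
definition vol :: real where "vol = (\<Sum>x\<in>V. deg x)"

lemma finite_nbr: "x \<in> V \<Longrightarrow> finite (N x)"
  using finite_V nbr_subset finite_subset by blast

lemma nbr_in_V: "x \<in> V \<Longrightarrow> y \<in> N x \<Longrightarrow> y \<in> V"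
  using nbr_subset by blast

lemma deg_ge_1: "x \<in> V \<Longrightarrow> deg x \<ge> 1"
  unfolding deg_def using nbr_nonempty finite_nbr
  by (metis One_nat_def Suc_leI card_gt_0_iff of_nat_1 of_nat_mono)

lemma deg_pos: "x \<in> V \<Longrightarrow> deg x > 0"
  using deg_ge_1 by fastforce

lemma card_le_vol: "real (card V) \<le> vol"
proof -
  have "real (card V) = (\<Sum>x\<in>V. 1)" by simp
  also have "\<dots> \<le> vol" unfolding vol_def by (intro sum_mono deg_ge_1)
  finally show ?thesis .
qed

lemma vol_pos: "x \<in> V \<Longrightarrow> vol > 0"
  unfolding vol_def using deg_pos finite_V by (intro sum_pos) auto

lemma deg_avg: "x \<in> V \<Longrightarrow> deg x * avg f x = (\<Sum>y\<in>N x. f y)"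
  using deg_pos[of x] by (simp add: avg_def)

lemma double_sum_swap:
  "(\<Sum>x\<in>V. \<Sum>y\<in>N x. \<phi> x y) = (\<Sum>x\<in>V. \<Sum>y\<in>N x. \<phi> y x :: real)"
proof -
  have *: "(\<Sum>x\<in>V. \<Sum>y\<in>N x. \<phi> x y) = (\<Sum>(x,y)\<in>Sigma V N. \<phi> x y)" for \<phi> :: "'v \<Rightarrow> 'v \<Rightarrow> real"
    by (rule sum.Sigma) (auto simp: finite_V finite_nbr)
  show ?thesis unfolding *
    by (rule sum.reindex_bij_witness[of _ prod.swap prod.swap])
       (auto dest: nbr_sym nbr_in_V)
qed

lemma avg_cong: "x \<in> V \<Longrightarrow> (\<And>y. y \<in> V \<Longrightarrow> f y = g y) \<Longrightarrow> avg f x = avg g x"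
  unfolding avg_def using nbr_in_V by (metis (no_types, lifting) sum.cong)

lemma avg_mono: "x \<in> V \<Longrightarrow> (\<And>y. y \<in> V \<Longrightarrow> f y \<le> g y) \<Longrightarrow> avg f x \<le> avg g x"
  unfolding avg_def using nbr_in_V deg_pos[of x] by (intro divide_right_mono sum_mono) auto

lemma avg_const [simp]: "x \<in> V \<Longrightarrow> avg (\<lambda>_. c) x = c"
  using deg_pos[of x] by (simp add: avg_def deg_def)

lemma avg_add: "avg (\<lambda>y. f y + g y) x = avg f x + avg g x"
  by (simp add: avg_def sum.distrib add_divide_distrib)

lemma avg_diff_const: "x \<in> V \<Longrightarrow> avg (\<lambda>y. f y - c) x = avg f x - c"
  using deg_pos[of x] by (simp add: avg_def sum_subtractf diff_divide_distrib deg_def)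

lemma avg_scale: "avg (\<lambda>y. c * f y) x = c * avg f x"
  by (simp add: avg_def sum_distrib_left[symmetric])

lemma ip_commute: "ip f g = ip g f"
  by (simp add: ip_def mult_ac)

lemma ip_cong: "(\<And>x. x \<in> V \<Longrightarrow> f x = f' x) \<Longrightarrow> (\<And>x. x \<in> V \<Longrightarrow> g x = g' x) \<Longrightarrow> ip f g = ip f' g'"
  unfolding ip_def by (intro sum.cong) auto

lemma ip_avg: "ip f (avg g) = (\<Sum>x\<in>V. \<Sum>y\<in>N x. f x * g y)"
  unfolding ip_def
proof (intro sum.cong refl)
  fix x assume "x \<in> V"
  have "deg x * f x * avg g x = f x * (deg x * avg g x)" by simp
  also have "\<dots> = (\<Sum>y\<in>N x. f x * g y)" by (simp add: deg_avg \<open>x \<in> V\<close> sum_distrib_left)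
  finally show "deg x * f x * avg g x = (\<Sum>y\<in>N x. f x * g y)" .
qed

lemma ip_avg_sym: "ip f (avg g) = ip (avg f) g"
proof -
  have "ip f (avg g) = (\<Sum>x\<in>V. \<Sum>y\<in>N x. f y * g x)"
    unfolding ip_avg by (rule double_sum_swap)
  also have "\<dots> = ip g (avg f)" unfolding ip_avg by (simp add: mult.commute)
  finally show ?thesis by (simp add: ip_commute)
qed

lemma ip_funpow_sym: "ip f ((avg ^^ t) g) = ip ((avg ^^ t) f) g"
proof (induction t arbitrary: f)
  case (Suc t)
  have "ip f ((avg ^^ Suc t) g) = ip ((avg ^^ t) (avg f)) g"
    using Suc[of "avg f"] by (simp add: ip_avg_sym)
  then show ?case by (simp add: funpow_swap1)
qed simp

lemma ip_nonneg: "ip f f \<ge> 0"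
  unfolding ip_def by (intro sum_nonneg) (simp add: deg_pos less_imp_le mult.assoc)

lemma ip_one_avg: "ip (\<lambda>_. 1) (avg f) = ip (\<lambda>_. 1) f"
  unfolding ip_avg_sym by (rule ip_cong) auto

lemma ip_one_funpow: "ip (\<lambda>_. 1) ((avg ^^ t) f) = ip (\<lambda>_. 1) f"
  by (induction t) (auto simp: ip_one_avg)

lemma ip_Cauchy_Schwarz: "(ip f g)\<^sup>2 \<le> ip f f * ip g g"
proof -
  have "ip f g = (\<Sum>x\<in>V. (sqrt (deg x) * f x) * (sqrt (deg x) * g x))" for f g
    unfolding ip_def using deg_pos
    by (intro sum.cong refl) (metis (no_types, lifting) less_imp_le mult.assoc mult.left_commute real_sqrt_mult_self abs_of_pos)
  moreover have "(\<Sum>x\<in>V. (sqrt (deg x) * f x) * (sqrt (deg x) * g x))\<^sup>2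
     \<le> (\<Sum>x\<in>V. (sqrt (deg x) * f x)\<^sup>2) * (\<Sum>x\<in>V. (sqrt (deg x) * g x)\<^sup>2)"
    by (rule Cauchy_Schwarz_ineq_sum)
  ultimately show ?thesis by (simp add: power2_eq_square)
qed

lemma funpow_mono_const:
  assumes "\<And>x. x \<in> V \<Longrightarrow> avg f x \<le> f x + \<kappa>" "x \<in> V"
  shows "(avg ^^ t) f x \<le> f x + real t * \<kappa>"
  using assms(2)
proof (induction t arbitrary: x)
  case (Suc t)
  have "avg ((avg ^^ t) f) x \<le> avg (\<lambda>y. f y + real t * \<kappa>) x"
    using Suc by (intro avg_mono) auto
  also have "\<dots> = avg f x + real t * \<kappa>" using avg_add[of f "\<lambda>_. real t * \<kappa>"] Suc.prems by simp
  also have "\<dots> \<le> f x + \<kappa> + real t * \<kappa>" using assms(1) Suc.prems by simp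
  finally show ?case by (simp add: algebra_simps)
qed simp

lemma funpow_mono:
  assumes "\<And>x. x \<in> V \<Longrightarrow> f x \<le> g x" "x \<in> V"
  shows "(avg ^^ t) f x \<le> (avg ^^ t) g x"
  using assms(2)
  by (induction t arbitrary: x) (auto intro: assms(1) avg_mono)

lemma funpow_const: "x \<in> V \<Longrightarrow> (avg ^^ t) (\<lambda>_. c) x = c"
proof (induction t arbitrary: x)
  case (Suc t)
  have "avg ((avg ^^ t) (\<lambda>_. c)) x = avg (\<lambda>_. c) x" using Suc by (intro avg_cong) auto
  then show ?case using Suc.prems by simp
qed simp

lemma funpow_nonneg:
  assumes "\<And>x. x \<in> V \<Longrightarrow> 0 \<le> f x" "x \<in> V"
  shows "0 \<le> (avg ^^ t) f x"
  using funpow_mono[of "\<lambda>_. 0" f x t] assms funpow_const[of x t 0] by simp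

lemma funpow_diff_const: "x \<in> V \<Longrightarrow> (avg ^^ t) (\<lambda>y. f y - c) x = (avg ^^ t) f x - c"
proof (induction t arbitrary: x)
  case (Suc t)
  have "avg ((avg ^^ t) (\<lambda>y. f y - c)) x = avg (\<lambda>y. (avg ^^ t) f y - c) x"
    using Suc by (intro avg_cong) auto
  then show ?case using Suc.prems by (simp add: avg_diff_const)
qed simp

text \<open>
  Barta's bound on the Dirichlet eigenvalue. By the inequality between arithmetic and geometric mean,
  \<open>2 * f x * f y\<close> is at most \<open>(f x)\<^sup>2 * W y / W x + (f y)\<^sup>2 * W x / W y\<close>.
\<close>
lemma barta:
  assumes W_nonneg: "\<And>x. x \<in> V \<Longrightarrow> W x \<ge> 0"
    and W_pos: "\<And>x. x \<in> V \<Longrightarrow> x \<notin> Z \<Longrightarrow> W x > 0"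
    and super: "\<And>x. x \<in> V \<Longrightarrow> x \<notin> Z \<Longrightarrow> (\<Sum>y\<in>N x. W x - W y) \<ge> \<kappa> * W x"
    and vanish: "\<And>x. x \<in> V \<Longrightarrow> x \<in> Z \<Longrightarrow> f x = 0"
  shows "2 * \<kappa> * (\<Sum>x\<in>V. (f x)\<^sup>2) \<le> dirichlet f"
proof -
  define \<phi> where "\<phi> x y = (f x)\<^sup>2 * (1 - W y / W x)" for x y
  have edge: "(f x - f y)\<^sup>2 \<ge> \<phi> x y + \<phi> y x" if x: "x \<in> V" and y: "y \<in> N x" for x y
  proof -
    have yV: "y \<in> V" using nbr_in_V x y by blast
    have pos: "W x > 0" if "f x \<noteq> 0" using W_pos vanish x that by blast
    have pos': "W y > 0" if "f y \<noteq> 0" using W_pos vanish yV that by blast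
    consider "f x = 0" | "f y = 0" | "f x \<noteq> 0" "f y \<noteq> 0" by blast
    then show ?thesis
    proof cases
      case 1
      have "W x / W y \<ge> 0" using W_nonneg x yV by simp
      then have "(f y)\<^sup>2 * (1 - W x / W y) \<le> (f y)\<^sup>2 * 1" by (intro mult_left_mono) auto
      then show ?thesis using 1 by (simp add: \<phi>_def)
    next
      case 2
      have "W y / W x \<ge> 0" using W_nonneg x yV by simp
      then have "(f x)\<^sup>2 * (1 - W y / W x) \<le> (f x)\<^sup>2 * 1" by (intro mult_left_mono) auto
      then show ?thesis using 2 by (simp add: \<phi>_def)
    next
      case 3
      then have wx: "W x > 0" and wy: "W y > 0" using pos pos' by auto
      define r where "r = sqrt (W y / W x)"
      have r2: "r\<^sup>2 = W y / W x" "r > 0" using wx wy by (auto simp: r_def)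
      have r3: "(1/r)\<^sup>2 = W x / W y" using r2 by (simp add: power_divide)
      have "0 \<le> (f x * r - f y * (1/r))\<^sup>2" by simp
      also have "\<dots> = (f x)\<^sup>2 * r\<^sup>2 + (f y)\<^sup>2 * (1/r)\<^sup>2 - 2 * f x * f y"
        using r2(2) by (simp add: power2_diff power_mult_distrib power_divide)
      finally have "2 * f x * f y \<le> (f x)\<^sup>2 * (W y / W x) + (f y)\<^sup>2 * (W x / W y)"
        unfolding r2 r3 by simp
      then show ?thesis by (simp add: \<phi>_def power2_diff algebra_simps)
    qed
  qed
  have "2 * \<kappa> * (\<Sum>x\<in>V. (f x)\<^sup>2) = 2 * (\<Sum>x\<in>V. \<kappa> * (f x)\<^sup>2)" by (simp add: sum_distrib_left mult.assoc)
  also have "(\<Sum>x\<in>V. \<kappa> * (f x)\<^sup>2) \<le> (\<Sum>x\<in>V. \<Sum>y\<in>N x. \<phi> x y)"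
  proof (rule sum_mono)
    fix x assume x: "x \<in> V"
    show "\<kappa> * (f x)\<^sup>2 \<le> (\<Sum>y\<in>N x. \<phi> x y)"
    proof (cases "f x = 0")
      case False
      then have w: "W x > 0" and nz: "x \<notin> Z" using W_pos vanish x by blast+
      have "(\<Sum>y\<in>N x. \<phi> x y) = (f x)\<^sup>2 / W x * (\<Sum>y\<in>N x. W x - W y)"
        unfolding sum_distrib_left \<phi>_def using w by (intro sum.cong) (auto simp: field_simps)
      also have "\<dots> \<ge> (f x)\<^sup>2 / W x * (\<kappa> * W x)"
        using super[OF x nz] w by (intro mult_left_mono) auto
      also have "(f x)\<^sup>2 / W x * (\<kappa> * W x) = \<kappa> * (f x)\<^sup>2" using w by simp
      finally show ?thesis by simp
    qed (simp add: \<phi>_def)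
  qed
  also have "2 * (\<Sum>x\<in>V. \<Sum>y\<in>N x. \<phi> x y) = (\<Sum>x\<in>V. \<Sum>y\<in>N x. \<phi> x y + \<phi> y x)"
    using double_sum_swap[of \<phi>] by (simp add: sum.distrib)
  also have "\<dots> \<le> dirichlet f"
    unfolding dirichlet_def by (intro sum_mono edge)
  finally show ?thesis by simp
qed

lemma jensen_gap:
  assumes "finite A" "y' \<in> A" "g y' = (0::real)"
  shows "real (card A) * (\<Sum>y\<in>A. (g y)\<^sup>2) - (\<Sum>y\<in>A. g y)\<^sup>2 \<ge> (\<Sum>y\<in>A. (g y)\<^sup>2)"
proof -
  have s: "(\<Sum>y\<in>A. g y) = (\<Sum>y\<in>A - {y'}. g y)" "(\<Sum>y\<in>A. (g y)\<^sup>2) = (\<Sum>y\<in>A - {y'}. (g y)\<^sup>2)"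
    using assms by (simp_all add: sum.remove)
  have "(\<Sum>y\<in>A - {y'}. 1 * g y)\<^sup>2 \<le> (\<Sum>y\<in>A - {y'}. 1\<^sup>2) * (\<Sum>y\<in>A - {y'}. (g y)\<^sup>2)"
    by (rule Cauchy_Schwarz_ineq_sum)
  also have "(\<Sum>y\<in>A - {y'}. 1\<^sup>2::real) = real (card A) - 1"
  proof -
    have "card A \<ge> 1" using assms by (metis One_nat_def Suc_leI card_gt_0_iff empty_iff)
    then show ?thesis using assms by (simp add: of_nat_diff)
  qed
  finally show ?thesis unfolding s by (simp add: algebra_simps)
qed

lemma local_variance:
  assumes x: "x \<in> V" and y': "y' \<in> N x" "f y' = f x"
  shows "deg x * avg (\<lambda>y. (f y)\<^sup>2) x - deg x * (avg f x)\<^sup>2 \<ge> (\<Sum>y\<in>N x. (f y - f x)\<^sup>2) / deg x"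
proof -
  have d: "deg x > 0" using deg_pos x by simp
  define s1 where "s1 = (\<Sum>y\<in>N x. f y)"
  define s2 where "s2 = (\<Sum>y\<in>N x. (f y)\<^sup>2)"
  have e1: "(\<Sum>y\<in>N x. f y - f x) = s1 - deg x * f x" by (simp add: s1_def sum_subtractf deg_def)
  have e2: "(\<Sum>y\<in>N x. (f y - f x)\<^sup>2) = s2 - 2 * f x * s1 + deg x * (f x)\<^sup>2"
    by (simp add: s1_def s2_def power2_diff sum_subtractf sum.distrib deg_def sum_distrib_left sum_distrib_right mult_ac)
  have "(\<Sum>y\<in>N x. (f y - f x)\<^sup>2) \<le> deg x * (\<Sum>y\<in>N x. (f y - f x)\<^sup>2) - (\<Sum>y\<in>N x. f y - f x)\<^sup>2"
    unfolding deg_def using jensen_gap[of "N x" y' "\<lambda>y. f y - f x"] finite_nbr x y' by simp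
  also have "\<dots> = deg x * s2 - s1\<^sup>2"
    unfolding e1 e2 by (simp add: power2_eq_square algebra_simps)
  also have "\<dots> = deg x * (deg x * avg (\<lambda>y. (f y)\<^sup>2) x - deg x * (avg f x)\<^sup>2)"
    using d by (simp add: avg_def s1_def s2_def power2_eq_square field_simps)
  finally show ?thesis using d by (simp add: divide_le_eq mult.commute)
qed

lemma avg_square_le: assumes x: "x \<in> V" shows "(avg f x)\<^sup>2 \<le> avg (\<lambda>y. (f y)\<^sup>2) x"
proof -
  have d: "deg x > 0" using deg_pos x by simp
  have "(\<Sum>y\<in>N x. 1 * f y)\<^sup>2 \<le> (\<Sum>y\<in>N x. 1\<^sup>2) * (\<Sum>y\<in>N x. (f y)\<^sup>2)"
    by (rule Cauchy_Schwarz_ineq_sum)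
  then have "(\<Sum>y\<in>N x. f y)\<^sup>2 \<le> deg x * (\<Sum>y\<in>N x. (f y)\<^sup>2)" by (simp add: deg_def)
  then show ?thesis using d by (simp add: avg_def power_divide field_simps power2_eq_square)
qed

lemma ip_as_avg: "ip f f = (\<Sum>x\<in>V. deg x * avg (\<lambda>y. (f y)\<^sup>2) x)"
proof -
  have "ip f f = ip (\<lambda>_. 1) (\<lambda>y. (f y)\<^sup>2)" by (simp add: ip_def power2_eq_square mult_ac)
  also have "\<dots> = ip (\<lambda>_. 1) (avg (\<lambda>y. (f y)\<^sup>2))" by (rule ip_one_avg[symmetric])
  finally show ?thesis by (simp add: ip_def)
qed

lemma ip_avg_le: "ip (avg f) (avg f) \<le> ip f f"
proof -
  have "deg x * avg f x * avg f x \<le> deg x * avg (\<lambda>y. (f y)\<^sup>2) x" if x: "x \<in> V" for x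
    using avg_square_le[OF x] deg_pos[OF x] by (simp add: power2_eq_square mult.assoc)
  then show ?thesis unfolding ip_as_avg[of f] by (simp add: ip_def sum_mono)
qed

lemma ip_funpow_antimono: "s \<le> t \<Longrightarrow> ip ((avg ^^ t) f) ((avg ^^ t) f) \<le> ip ((avg ^^ s) f) ((avg ^^ s) f)"
  by (induction t rule: dec_induct) (auto intro: order_trans[OF ip_avg_le])

text \<open>
  The loss of norm in one step is the variance of \<open>f\<close> over a random neighbour. If one of the
  neighbours of \<open>x\<close> has the value \<open>f x\<close>, this variance controls all differences
  along the edges at \<open>x\<close>. Only the root may fail to have such a neighbour; its edges are
  counted from their other ends.
\<close>
lemma lazy_contraction:
  assumes D: "\<And>x. x \<in> V \<Longrightarrow> deg x \<le> D" and r: "r \<in> V"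
    and lazy: "\<And>x. x \<in> V \<Longrightarrow> x \<noteq> r \<Longrightarrow> \<exists>y\<in>N x. f y = f x"
  shows "ip f f - ip (avg f) (avg f) \<ge> dirichlet f / (2 * D)"
proof -
  define S where "S x = (\<Sum>y\<in>N x. (f y - f x)\<^sup>2)" for x
  have S0: "S x \<ge> 0" for x by (simp add: S_def sum_nonneg)
  have Dpos: "D > 0" using D[OF r] deg_pos[OF r] by simp
  have dS: "dirichlet f = (\<Sum>x\<in>V. S x)"
    by (simp add: dirichlet_def S_def power2_commute)
  have "S r = (\<Sum>y\<in>N r. (f y - f r)\<^sup>2)" by (simp add: S_def)
  also have "\<dots> \<le> (\<Sum>y\<in>N r. S y)"
  proof (rule sum_mono)
    fix y assume y: "y \<in> N r"
    have "r \<in> N y" "finite (N y)" using y r nbr_sym nbr_in_V finite_nbr by blast+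
    then have "(f r - f y)\<^sup>2 \<le> S y" unfolding S_def
      by (intro member_le_sum[of r "N y" "\<lambda>z. (f z - f y)\<^sup>2"]) auto
    then show "(f y - f r)\<^sup>2 \<le> S y" by (simp add: power2_commute)
  qed
  also have "\<dots> \<le> (\<Sum>y\<in>V - {r}. S y)"
    using nbr_subset[OF r] nbr_irrefl[OF r] finite_V S0 by (intro sum_mono2) auto
  finally have "dirichlet f \<le> 2 * (\<Sum>y\<in>V - {r}. S y)"
    unfolding dS using r finite_V by (simp add: sum.remove)
  then have "dirichlet f / (2 * D) \<le> (\<Sum>y\<in>V - {r}. S y) / D"
    using Dpos by (simp add: field_simps)
  also have "\<dots> = (\<Sum>x\<in>V. if x = r then 0 else S x / D)"
    using finite_V r by (simp add: sum.remove sum_divide_distrib)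
  also have "\<dots> \<le> (\<Sum>x\<in>V. deg x * avg (\<lambda>y. (f y)\<^sup>2) x - deg x * (avg f x)\<^sup>2)"
  proof (rule sum_mono)
    fix x assume x: "x \<in> V"
    show "(if x = r then 0 else S x / D) \<le> deg x * avg (\<lambda>y. (f y)\<^sup>2) x - deg x * (avg f x)\<^sup>2"
    proof (cases "x = r")
      case True
      then show ?thesis using avg_square_le[OF x, of f] deg_pos[OF x] by simp
    next
      case False
      then obtain y' where "y' \<in> N x" "f y' = f x" using lazy x by blast
      then have "S x / deg x \<le> deg x * avg (\<lambda>y. (f y)\<^sup>2) x - deg x * (avg f x)\<^sup>2"
        unfolding S_def by (rule local_variance[OF x])
      moreover have "S x / D \<le> S x / deg x"
        using D[OF x] deg_pos[OF x] S0 by (intro divide_left_mono) auto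
      ultimately show ?thesis using False by simp
    qed
  qed
  also have "\<dots> = ip f f - ip (avg f) (avg f)"
    unfolding ip_as_avg[of f] by (simp add: sum_subtractf ip_def power2_eq_square mult.assoc)
  finally show ?thesis .
qed

end

section \<open>Walks with an equitable partition\<close>

text \<open>
  The classes form an equitable partition in which the root is alone. Class functions are thus
  preserved by averaging, and they contain the density of the law of the walk from the root.
\<close>
locale lumped_walk = finite_walk V N for V :: "'v set" and N +
  fixes cls :: "'v \<Rightarrow> 'c" and r :: 'v and D :: real
  assumes root: "r \<in> V"
    and equitable: "\<lbrakk>\<And>x y. x \<in> V \<Longrightarrow> y \<in> V \<Longrightarrow> cls x = cls y \<Longrightarrow> f x = f y;
        x \<in> V; y \<in> V; cls x = cls y\<rbrakk> \<Longrightarrow> (\<Sum>z\<in>N x. f z) = (\<Sum>z\<in>N y. f z :: real)"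
    and root_class: "x \<in> V \<Longrightarrow> cls x = cls r \<Longrightarrow> x = r"
    and lazy: "x \<in> V \<Longrightarrow> x \<noteq> r \<Longrightarrow> \<exists>y\<in>N x. cls y = cls x"
    and deg_le: "x \<in> V \<Longrightarrow> deg x \<le> D"
begin

definition class_fun :: "('v \<Rightarrow> real) \<Rightarrow> bool" where
  "class_fun f \<longleftrightarrow> (\<forall>x\<in>V. \<forall>y\<in>V. cls x = cls y \<longrightarrow> f x = f y)"

definition class_of :: "'v \<Rightarrow> 'v set" where "class_of x = {y\<in>V. cls y = cls x}"

text \<open>A Poincare inequality for class functions; the sum in \<open>dirichlet\<close> counts each edge twice.\<close>
definition gap :: "real \<Rightarrow> bool" where
  "gap \<kappa> \<longleftrightarrow> (\<forall>f. class_fun f \<longrightarrow> (\<exists>c. 2 * \<kappa> * (\<Sum>x\<in>V. (f x - c)\<^sup>2) \<le> dirichlet f))"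

text \<open>
  By reversibility this is the density of the law at time \<open>t\<close> with respect to the
  degrees, up to the factor \<open>deg r\<close>.
\<close>
definition law :: "nat \<Rightarrow> 'v \<Rightarrow> real" where
  "law t = (avg ^^ t) (indicator {r})"

lemma class_funI: "(\<And>x y. x \<in> V \<Longrightarrow> y \<in> V \<Longrightarrow> cls x = cls y \<Longrightarrow> f x = f y) \<Longrightarrow> class_fun f"
  unfolding class_fun_def by blast

lemma class_funD: "class_fun f \<Longrightarrow> x \<in> V \<Longrightarrow> y \<in> V \<Longrightarrow> cls x = cls y \<Longrightarrow> f x = f y"
  unfolding class_fun_def by blast

lemma D_ge_1: "D \<ge> 1"
  using deg_le[OF root] deg_ge_1[OF root] by simp

lemma class_fun_avg: "class_fun f \<Longrightarrow> class_fun (avg f)"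
  unfolding class_fun_def
proof (intro ballI impI)
  fix x y assume f: "\<forall>x\<in>V. \<forall>y\<in>V. cls x = cls y \<longrightarrow> f x = f y"
    and xy: "x \<in> V" "y \<in> V" "cls x = cls y"
  have "deg x = deg y" using equitable[of "\<lambda>_. 1" x y] xy by (simp add: deg_def)
  moreover have "(\<Sum>z\<in>N x. f z) = (\<Sum>z\<in>N y. f z)" using f by (intro equitable[OF _ xy]) blast
  ultimately show "avg f x = avg f y" by (simp add: avg_def)
qed

lemma class_fun_funpow: "class_fun f \<Longrightarrow> class_fun ((avg ^^ t) f)"
proof (induction t)
  case (Suc t)
  then show ?case using class_fun_avg[of "(avg ^^ t) f"] by simp
qed simp

lemma class_fun_indicator: "class_fun (indicator (class_of x))"
  by (auto simp: class_fun_def class_of_def indicator_def)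

lemma class_of_root: "class_of r = {r}"
  using root root_class by (auto simp: class_of_def)

lemma class_fun_law: "class_fun (law t)"
  unfolding law_def class_of_root[symmetric] by (intro class_fun_funpow class_fun_indicator)

text \<open>
  A class function is constant on a single class \<open>Z\<close>, so that subtracting this constant
  makes Barta's bound applicable.
\<close>
lemma gapI:
  assumes W_nonneg: "\<And>x. x \<in> V \<Longrightarrow> W x \<ge> 0"
    and W_pos: "\<And>x. x \<in> V \<Longrightarrow> x \<notin> Z \<Longrightarrow> W x > 0"
    and super: "\<And>x. x \<in> V \<Longrightarrow> x \<notin> Z \<Longrightarrow> (\<Sum>y\<in>N x. W x - W y) \<ge> \<kappa> * W x"
    and one_class: "\<And>x y. x \<in> V \<Longrightarrow> x \<in> Z \<Longrightarrow> y \<in> V \<Longrightarrow> y \<in> Z \<Longrightarrow> cls x = cls y"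
  shows "gap \<kappa>"
  unfolding gap_def
proof (intro allI impI)
  fix f assume f: "class_fun f"
  obtain c where c: "\<And>x. x \<in> V \<Longrightarrow> x \<in> Z \<Longrightarrow> f x = c"
  proof (cases "V \<inter> Z = {}")
    case False
    then obtain z where "z \<in> V" "z \<in> Z" by blast
    then have "f x = f z" if "x \<in> V" "x \<in> Z" for x
      using f one_class that unfolding class_fun_def by blast
    then show ?thesis using that by blast
  qed (use that in auto)
  have "2 * \<kappa> * (\<Sum>x\<in>V. (f x - c)\<^sup>2) \<le> dirichlet (\<lambda>x. f x - c)"
    using c by (intro barta[of W Z] assms) auto
  then show "\<exists>c. 2 * \<kappa> * (\<Sum>x\<in>V. (f x - c)\<^sup>2) \<le> dirichlet f"
    by (auto simp: dirichlet_def)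
qed

lemma variance_le:
  assumes m: "m = ip (\<lambda>_. 1) f / vol"
  shows "ip (\<lambda>x. f x - m) (\<lambda>x. f x - m) \<le> ip (\<lambda>x. f x - c) (\<lambda>x. f x - c)"
proof -
  have e: "ip (\<lambda>x. f x - a) (\<lambda>x. f x - a) = ip f f - 2 * a * ip (\<lambda>_. 1) f + a\<^sup>2 * vol" for a
    by (simp add: ip_def vol_def sum_distrib_left sum.distrib sum_subtractf algebra_simps power2_eq_square)
  have mv: "ip (\<lambda>_. 1) f = m * vol" using m vol_pos[OF root] by simp
  have "ip (\<lambda>x. f x - c) (\<lambda>x. f x - c) - ip (\<lambda>x. f x - m) (\<lambda>x. f x - m) = (m - c)\<^sup>2 * vol"
    unfolding e mv by (simp add: power2_eq_square algebra_simps)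
  then show ?thesis using vol_pos[OF root] by (metis diff_ge_0_iff_ge less_imp_le zero_le_mult_iff zero_le_power2)
qed

lemma variance_contraction:
  assumes gap: "gap \<kappa>" and k: "0 \<le> \<kappa>" and f: "class_fun f" and m: "m = ip (\<lambda>_. 1) f / vol"
  shows "ip (\<lambda>x. avg f x - m) (\<lambda>x. avg f x - m) \<le> (1 - \<kappa> / D\<^sup>2) * ip (\<lambda>x. f x - m) (\<lambda>x. f x - m)"
proof -
  let ?h = "\<lambda>x. f x - m"
  have D: "D > 0" using D_ge_1 by simp
  obtain c where c: "2 * \<kappa> * (\<Sum>x\<in>V. (f x - c)\<^sup>2) \<le> dirichlet f"
    using gap f unfolding gap_def by blast
  have "ip ?h ?h \<le> ip (\<lambda>x. f x - c) (\<lambda>x. f x - c)" by (rule variance_le[OF m])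
  also have "\<dots> = (\<Sum>x\<in>V. deg x * (f x - c)\<^sup>2)" by (simp add: ip_def power2_eq_square mult.assoc)
  also have "\<dots> \<le> (\<Sum>x\<in>V. D * (f x - c)\<^sup>2)" by (intro sum_mono mult_right_mono deg_le) auto
  also have "\<dots> = D * (\<Sum>x\<in>V. (f x - c)\<^sup>2)" by (simp add: sum_distrib_left)
  finally have "2 * \<kappa> * ip ?h ?h \<le> 2 * \<kappa> * (D * (\<Sum>x\<in>V. (f x - c)\<^sup>2))"
    using k by (intro mult_left_mono) auto
  also have "\<dots> \<le> D * dirichlet f" using c D by (simp add: mult.left_commute)
  finally have 1: "\<kappa> / D\<^sup>2 * ip ?h ?h \<le> dirichlet f / (2 * D)"
    using D by (simp add: field_simps power2_eq_square)
  have "dirichlet ?h / (2 * D) \<le> ip ?h ?h - ip (avg ?h) (avg ?h)"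
  proof (rule lazy_contraction[OF deg_le root])
    fix x assume x: "x \<in> V" "x \<noteq> r"
    then obtain y where y: "y \<in> N x" "cls y = cls x" using lazy by blast
    then have "f y = f x" using f x nbr_in_V unfolding class_fun_def by blast
    then show "\<exists>y\<in>N x. f y - m = f x - m" using y by auto
  qed
  moreover have "dirichlet ?h = dirichlet f" by (simp add: dirichlet_def)
  moreover have "ip (avg ?h) (avg ?h) = ip (\<lambda>x. avg f x - m) (\<lambda>x. avg f x - m)"
    by (intro ip_cong avg_diff_const) auto
  ultimately show ?thesis using 1 by (simp add: algebra_simps)
qed

lemma variance_decay:
  assumes gap: "gap \<kappa>" and k: "0 \<le> \<kappa>" "\<kappa> \<le> 1" and f: "class_fun f" and m: "m = ip (\<lambda>_. 1) f / vol"
  shows "ip (\<lambda>x. (avg ^^ t) f x - m) (\<lambda>x. (avg ^^ t) f x - m)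
    \<le> (1 - \<kappa> / D\<^sup>2) ^ t * ip (\<lambda>x. f x - m) (\<lambda>x. f x - m)"
proof (induction t)
  case (Suc t)
  have m': "m = ip (\<lambda>_. 1) ((avg ^^ t) f) / vol" by (simp add: ip_one_funpow m)
  have "D\<^sup>2 \<ge> 1" using D_ge_1 by (simp add: one_le_power)
  then have "\<kappa> / D\<^sup>2 \<le> 1" using k by (simp add: divide_le_eq)
  then have "(1 - \<kappa> / D\<^sup>2) * ip (\<lambda>x. (avg ^^ t) f x - m) (\<lambda>x. (avg ^^ t) f x - m)
     \<le> (1 - \<kappa> / D\<^sup>2) * ((1 - \<kappa> / D\<^sup>2) ^ t * ip (\<lambda>x. f x - m) (\<lambda>x. f x - m))"
    using Suc by (intro mult_left_mono) auto
  then show ?case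
    using variance_contraction[OF gap k(1) class_fun_funpow[OF f] m'] by (simp add: mult.assoc)
qed simp

lemma ip_indicator: 
  assumes A: "A \<subseteq> V" 
  shows "ip (indicator A) f = (\<Sum>x\<in>A. deg x * f x)"
proof -
  have "ip (indicator A) f = (\<Sum>x\<in>V. if x \<in> A then deg x * f x else 0)"
    unfolding ip_def by (intro sum.cong) (auto simp: indicator_def)
  also have "\<dots> = (\<Sum>x\<in>A. deg x * f x)"
    using A finite_V by (simp add: sum.If_cases Int_absorb1)
  finally show ?thesis .
qed

lemma mean_law: "ip (\<lambda>_. 1) (indicator {r}) = deg r"
  using ip_indicator[of "{r}" "\<lambda>_. 1"] root by (simp add: ip_commute)

lemma sqrt_pow_mult_cancel:
  assumes "a\<^sup>2 \<le> q * b\<^sup>2" "0 \<le> q" "0 \<le> (b::real)"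
  shows "\<bar>a\<bar> \<le> sqrt q * b"
proof -
  have "\<bar>a\<bar> = sqrt (a\<^sup>2)" by simp
  also have "\<dots> \<le> sqrt (q * b\<^sup>2)" using assms(1) by (rule real_sqrt_le_mono)
  also have "\<dots> = sqrt q * b" using assms by (simp add: real_sqrt_mult)
  finally show ?thesis .
qed

lemma contraction_factor: "0 \<le> \<kappa> \<Longrightarrow> \<kappa> \<le> 1 \<Longrightarrow> 0 \<le> 1 - \<kappa> / D\<^sup>2"
proof -
  assume "0 \<le> \<kappa>" "\<kappa> \<le> 1"
  moreover have "D\<^sup>2 \<ge> 1" using D_ge_1 by (simp add: one_le_power)
  ultimately show ?thesis by (simp add: divide_le_eq)
qed

text \<open>
  The supremum norm is bounded by the norm in \<open>ip\<close>, as all degrees are at least 1. This costs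
  the factor \<open>vol\<close>.
\<close>
theorem sup_deviation_from_gap:
  assumes gap: "gap \<kappa>" and k: "0 \<le> \<kappa>" "\<kappa> \<le> 1" and y: "y \<in> V"
  shows "\<bar>vol * law t y / deg r - 1\<bar> \<le> vol * sqrt ((1 - \<kappa> / D\<^sup>2) ^ t)"
proof -
  define m where "m = deg r / vol"
  define q where "q = (1 - \<kappa> / D\<^sup>2) ^ t"
  have q: "q \<ge> 0" using contraction_factor[OF k] by (simp add: q_def)
  have m: "m = ip (\<lambda>_. 1) (indicator {r}) / vol" by (simp add: m_def mean_law)
  have dr: "deg r \<ge> 1" using deg_ge_1 root by blast
  have v: "vol > 0" using vol_pos root by blast
  have "(law t y - m)\<^sup>2 \<le> deg y * (law t y - m)\<^sup>2"
    using deg_ge_1[OF y] by (simp add: mult_le_cancel_right1)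
  also have "\<dots> \<le> (\<Sum>x\<in>V. deg x * (law t x - m)\<^sup>2)"
    using y finite_V deg_pos by (intro member_le_sum[of y V "\<lambda>x. deg x * (law t x - m)\<^sup>2"]) (auto simp: less_imp_le)
  also have "\<dots> = ip (\<lambda>x. law t x - m) (\<lambda>x. law t x - m)" by (simp add: ip_def power2_eq_square mult.assoc)
  also have "\<dots> \<le> q * ip (\<lambda>x. indicator {r} x - m) (\<lambda>x. indicator {r} x - m)"
    unfolding law_def q_def using class_fun_indicator[of r] class_of_root m
    by (intro variance_decay gap k) auto
  also have "\<dots> \<le> q * ip (\<lambda>x. indicator {r} x - 0) (\<lambda>x. indicator {r} x - 0)"
    using q by (intro mult_left_mono variance_le m)
  also have "\<dots> = q * deg r" using ip_indicator[of "{r}" "indicator {r}"] root by simp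
  also have "\<dots> \<le> q * (deg r)\<^sup>2" using q dr by (intro mult_left_mono) (auto simp: power2_eq_square)
  finally have "\<bar>law t y - m\<bar> \<le> sqrt q * deg r" using q dr by (intro sqrt_pow_mult_cancel) auto
  then have "vol / deg r * \<bar>law t y - m\<bar> \<le> vol / deg r * (sqrt q * deg r)"
    using v dr by (intro mult_left_mono) auto
  moreover have "vol * law t y / deg r - 1 = vol / deg r * (law t y - m)"
    using v dr by (simp add: m_def field_simps)
  ultimately show ?thesis using v dr by (simp add: abs_mult q_def)
qed

definition class_deg :: "'v \<Rightarrow> real" where "class_deg x = (\<Sum>y\<in>class_of x. deg y)"

lemma class_of_subset: "class_of x \<subseteq> V" by (auto simp: class_of_def)

lemma class_deg_ge_1: "x \<in> V \<Longrightarrow> class_deg x \<ge> 1"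
proof -
  assume x: "x \<in> V"
  have "deg x \<le> class_deg x" unfolding class_deg_def
    using x class_of_subset[of x] finite_subset[OF class_of_subset finite_V] deg_pos
    by (intro member_le_sum) (auto simp: class_of_def less_imp_le)
  then show ?thesis using deg_ge_1[OF x] by simp
qed

lemma ip_class: 
  assumes f: "class_fun f" and x: "x \<in> V"
  shows "ip (indicator (class_of x)) f = class_deg x * f x"
proof -
  have "ip (indicator (class_of x)) f = (\<Sum>y\<in>class_of x. deg y * f y)"
    by (rule ip_indicator[OF class_of_subset])
  also have "\<dots> = (\<Sum>y\<in>class_of x. deg y * f x)"
  proof (intro sum.cong refl)
    fix y assume "y \<in> class_of x"
    then have y: "y \<in> V" "cls y = cls x" by (auto simp: class_of_def)
    have "f y = f x" by (rule class_funD[OF f y(1) x y(2)])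
    then show "deg y * f y = deg y * f x" by simp
  qed
  finally show ?thesis by (simp add: class_deg_def sum_distrib_right)
qed

text \<open>The expected number of visits to the class of \<open>x0\<close> before time \<open>n\<close>, from \<open>x\<close>.\<close>
definition green :: "nat \<Rightarrow> 'v \<Rightarrow> 'v \<Rightarrow> real" where
  "green n x0 x = (\<Sum>t<n. (avg ^^ t) (indicator (class_of x0)) x)"

lemma green_Suc: "green (Suc n) x0 x = indicator (class_of x0) x + avg (green n x0) x"
proof -
  have "(\<Sum>t<n. (avg ^^ Suc t) (indicator (class_of x0)) x) = avg (green n x0) x"
  proof -
    have "avg (green n x0) x = (\<Sum>t<n. \<Sum>y\<in>N x. (avg ^^ t) (indicator (class_of x0)) y) / deg x"
      unfolding green_def[abs_def] avg_def by (subst sum.swap) (rule refl)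
    then show ?thesis by (simp add: avg_def sum_divide_distrib)
  qed
  then show ?thesis by (simp add: green_def sum.lessThan_Suc_shift del: sum.lessThan_Suc)
qed

lemma ip_sum_right: "ip f (\<lambda>x. \<Sum>t\<in>A. g t x) = (\<Sum>t\<in>A. ip f (g t))"
  unfolding ip_def sum_distrib_left by (rule sum.swap)

lemma class_fun_green: "class_fun (green n x0)"
proof -
  have "class_fun ((avg ^^ t) (indicator (class_of x0)))" for t
    by (rule class_fun_funpow[OF class_fun_indicator])
  from class_funD[OF this] show ?thesis unfolding green_def
    by (intro class_funI sum.cong refl)
qed

lemma green_nonneg: "x \<in> V \<Longrightarrow> 0 \<le> green n x0 x"
  unfolding green_def by (intro sum_nonneg funpow_nonneg) auto

lemma green_total: "ip (\<lambda>_. 1) (green n x0) = real n * class_deg x0"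
proof -
  have "ip (\<lambda>_. 1) (green n x0) = (\<Sum>t<n. ip (\<lambda>_. 1) ((avg ^^ t) (indicator (class_of x0))))"
    unfolding green_def[abs_def] by (rule ip_sum_right)
  also have "\<dots> = (\<Sum>t<n. class_deg x0)"
    using ip_indicator[OF class_of_subset, of x0 "\<lambda>_. 1"]
    by (simp add: ip_one_funpow class_deg_def ip_commute)
  finally show ?thesis by simp
qed

text \<open>
  Outside \<open>L\<close> the walk drifts towards \<open>L\<close>, at an exponential rate measured by
  \<open>U\<close>; and the classes in \<open>L\<close> have large mass. In the application \<open>L\<close>
  consists of the leaves.
\<close>
context
  fixes U :: "'v \<Rightarrow> real" and L :: "'v set" and \<delta> \<sigma> :: real
  assumes U_pos: "\<And>x. x \<in> V \<Longrightarrow> U x > 0" and U_class: "class_fun U"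
    and d_pos: "\<delta> > 0" and s_pos: "\<sigma> > 0"
    and drift: "\<And>x. x \<in> V \<Longrightarrow> x \<notin> L \<Longrightarrow> avg U x \<le> (1 - \<delta>) * U x"
    and heavy: "\<And>x. x \<in> V \<Longrightarrow> x \<in> L \<Longrightarrow> \<sigma> \<le> class_deg x"
begin

text \<open>In a heavy class the value is at most the average over that class, hence at most a multiple of the total.\<close>
lemma green_heavy:
  assumes x: "x \<in> V" "x \<in> L" 
  shows "green n x0 x \<le> real n * class_deg x0 / \<sigma>"
proof -
  have "\<sigma> * green n x0 x \<le> class_deg x * green n x0 x"
    using heavy x green_nonneg by (intro mult_right_mono) auto
  also have "\<dots> = ip (indicator (class_of x)) (green n x0)"
    using ip_class[OF class_fun_green] x by simp
  also have "\<dots> \<le> ip (\<lambda>_. 1) (green n x0)"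
    unfolding ip_def using deg_pos green_nonneg
    by (intro sum_mono mult_right_mono) (auto simp: indicator_def less_imp_le)
  finally show ?thesis using s_pos by (simp add: green_total field_simps)
qed

text \<open>
  Before it reaches \<open>L\<close> the walk makes at most \<open>1 / \<delta>\<close> visits to a
  given class, from this class; afterwards the bound for heavy classes takes over. The induction on
  the time replaces a decomposition at the hitting time of \<open>L\<close>.
\<close>
lemma green_le:
  assumes x0: "x0 \<in> V"
  shows "x \<in> V \<Longrightarrow> green n x0 x \<le> U x / (U x0 * \<delta>) + real n * class_deg x0 / \<sigma>"
proof (induction n arbitrary: x)
  case 0
  then show ?case using U_pos[OF 0] U_pos[OF x0] d_pos by (simp add: green_def)
next
  case (Suc n)
  define B where "B = real n * class_deg x0 / \<sigma>"
  have c: "class_deg x0 \<ge> 1" using class_deg_ge_1 x0 by blast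
  have B: "B \<le> real (Suc n) * class_deg x0 / \<sigma>"
    using c s_pos unfolding B_def by (intro divide_right_mono mult_right_mono) auto
  have u: "U x > 0" "U x0 > 0" using U_pos Suc.prems x0 by auto
  show ?case
  proof (cases "x \<in> L")
    case True
    have "U x / (U x0 * \<delta>) \<ge> 0" using u d_pos by simp
    then show ?thesis using green_heavy[OF Suc.prems True, of "Suc n" x0] by linarith
  next
    case False
    define a where "a = 1 / (U x0 * \<delta>)"
    have a: "a > 0" using u d_pos by (simp add: a_def)
    have "avg (green n x0) x \<le> avg (\<lambda>y. a * U y + B) x"
      using Suc by (intro avg_mono) (auto simp: a_def B_def)
    also have "\<dots> = a * avg U x + B"
      using avg_add[of "\<lambda>y. a * U y" "\<lambda>_. B" x] Suc.prems by (simp add: avg_scale)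
    also have "a * avg U x \<le> a * ((1 - \<delta>) * U x)"
      using drift[OF Suc.prems False] a by (intro mult_left_mono) auto
    also have "a * ((1 - \<delta>) * U x) = a * U x - U x / U x0"
      using u d_pos by (simp add: a_def field_simps)
    finally have "green (Suc n) x0 x \<le> indicator (class_of x0) x + (a * U x - U x / U x0) + B"
      unfolding green_Suc by linarith
    also have "indicator (class_of x0) x \<le> U x / U x0"
    proof (cases "x \<in> class_of x0")
      case True
      then have "U x = U x0" using U_class x0 unfolding class_fun_def class_of_def by blast
      then show ?thesis using u by (simp add: indicator_def)
    qed (use u in \<open>simp add: indicator_def\<close>)
    finally have "green (Suc n) x0 x \<le> a * U x + B" by simp
    then show ?thesis using B unfolding a_def by simp
  qed
qed

text \<open>
  The norm of the iterates is the return probability at even times and hence decreases, so that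
  at time \<open>T\<close> it is at most its average up to that time, which is a Green function.
\<close>
lemma norm_after_smoothing:
  assumes x: "x \<in> V" and T: "T > 0"
  defines "f \<equiv> (avg ^^ T) (indicator (class_of x))"
  shows "ip f f \<le> (class_deg x)\<^sup>2 * (1 / (\<delta> * real T) + 2 / \<sigma>)"
proof -
  let ?i = "indicator (class_of x) :: 'v \<Rightarrow> real"
  define c where "c = class_deg x"
  have c: "c \<ge> 1" using class_deg_ge_1 x by (simp add: c_def)
  have sq: "ip ?i ((avg ^^ (2 * t)) ?i) = ip ((avg ^^ t) ?i) ((avg ^^ t) ?i)" for t
    using ip_funpow_sym[of ?i t "(avg ^^ t) ?i"] by (simp add: funpow_add mult_2)
  have nn: "ip ?i ((avg ^^ t) ?i) \<ge> 0" for t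
    unfolding ip_def using deg_pos funpow_nonneg[of ?i]
    by (intro sum_nonneg mult_nonneg_nonneg) (auto simp: less_imp_le indicator_def)
  have "real T * ip f f = (\<Sum>t<T. ip f f)" by simp
  also have "\<dots> \<le> (\<Sum>t<T. ip ?i ((avg ^^ (2 * t)) ?i))"
    unfolding sq f_def by (intro sum_mono ip_funpow_antimono) auto
  also have "\<dots> = (\<Sum>t\<in>(\<lambda>t. 2 * t) ` {..<T}. ip ?i ((avg ^^ t) ?i))"
    by (subst sum.reindex) (auto simp: inj_on_def)
  also have "\<dots> \<le> (\<Sum>t<2 * T. ip ?i ((avg ^^ t) ?i))"
    using nn by (intro sum_mono2) auto
  also have "\<dots> = ip ?i (green (2 * T) x)"
    unfolding green_def[abs_def] by (rule ip_sum_right[symmetric])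
  also have "\<dots> = c * green (2 * T) x x" using ip_class[OF class_fun_green x] by (simp add: c_def)
  also have "\<dots> \<le> c * (U x / (U x * \<delta>) + real (2 * T) * c / \<sigma>)"
    unfolding c_def using class_deg_ge_1[OF x] by (intro mult_left_mono green_le x) simp
  also have "\<dots> = c / \<delta> + real T * (c\<^sup>2 * 2 / \<sigma>)"
    using U_pos[OF x] by (simp add: power2_eq_square algebra_simps)
  also have "c / \<delta> \<le> c\<^sup>2 / \<delta>" using c d_pos by (intro divide_right_mono) (auto simp: power2_eq_square)
  finally have "real T * ip f f \<le> real T * (c\<^sup>2 * (1 / (\<delta> * real T) + 2 / \<sigma>))"
    using T by (simp add: algebra_simps)
  then show ?thesis using T by (simp add: c_def)
qed

text \<open>
  The first \<open>T\<close> steps turn the point mass at the root into a density that is bounded in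
  \<open>ip\<close>; the last \<open>T\<close> steps do the same, by duality, for the class at which the density
  is evaluated. Only in between the gap is used.
\<close>
theorem sup_deviation_after_smoothing:
  assumes gap: "gap \<kappa>" and k: "0 \<le> \<kappa>" "\<kappa> \<le> 1" and y: "y \<in> V" and T: "T > 0"
  shows "\<bar>vol * law (2 * T + t) y / deg r - 1\<bar>
    \<le> vol * (1 / (\<delta> * real T) + 2 / \<sigma>) * sqrt ((1 - \<kappa> / D\<^sup>2) ^ t)"
proof -
  define m where "m = deg r / vol"
  define q where "q = (1 - \<kappa> / D\<^sup>2) ^ t"
  define A where "A = 1 / (\<delta> * real T) + 2 / \<sigma>"
  have A: "A > 0" unfolding A_def using d_pos s_pos T by (intro add_pos_pos) auto
  have q: "q \<ge> 0" using contraction_factor[OF k] by (simp add: q_def)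
  have dr: "deg r \<ge> 1" using deg_ge_1 root by blast
  have v: "vol > 0" using vol_pos root by blast
  have cr: "class_deg r = deg r" by (simp add: class_deg_def class_of_root)
  let ?i = "indicator (class_of y) :: 'v \<Rightarrow> real"
  define f where "f = (avg ^^ T) ?i"
  define h where "h = law T"
  define h' where "h' = (\<lambda>x. (avg ^^ t) h x - m)"
  have m: "m = ip (\<lambda>_. 1) h / vol" by (simp add: m_def h_def law_def ip_one_funpow mean_law)
  have fb: "ip f f \<le> (class_deg y)\<^sup>2 * A"
    unfolding f_def A_def by (rule norm_after_smoothing[OF y T])
  have "ip h h \<le> (deg r)\<^sup>2 * A"
    unfolding h_def A_def law_def
    using norm_after_smoothing[OF root T] by (simp add: class_of_root cr)
  moreover have "ip h' h' \<le> q * ip (\<lambda>x. h x - m) (\<lambda>x. h x - m)"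
    unfolding h'_def q_def by (intro variance_decay gap k m) (simp add: h_def class_fun_law)
  moreover have "ip (\<lambda>x. h x - m) (\<lambda>x. h x - m) \<le> ip h h"
    using variance_le[OF m, of 0] by simp
  ultimately have hb: "ip h' h' \<le> q * ((deg r)\<^sup>2 * A)"
    using q by (meson mult_left_mono order_trans)
  have "class_fun (\<lambda>x. law (2 * T + t) x - m)"
    using class_funD[OF class_fun_law] by (intro class_funI arg_cong2[where f = minus] refl)
  then have "class_deg y * (law (2 * T + t) y - m) = ip ?i (\<lambda>x. law (2 * T + t) x - m)"
    using ip_class y by simp
  also have "\<dots> = ip ?i ((avg ^^ T) h')"
  proof (intro ip_cong refl)
    fix x assume x: "x \<in> V"
    have "law (2 * T + t) = (avg ^^ T) ((avg ^^ t) h)"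
    proof -
      have "2 * T + t = T + (t + T)" by simp
      then show ?thesis unfolding law_def h_def by (simp only: funpow_add comp_apply)
    qed
    then show "law (2 * T + t) x - m = (avg ^^ T) h' x"
      using funpow_diff_const[OF x] by (simp add: h'_def)
  qed
  also have "\<dots> = ip f h'" unfolding f_def by (rule ip_funpow_sym)
  finally have "(class_deg y * (law (2 * T + t) y - m))\<^sup>2 \<le> ip f f * ip h' h'"
    using ip_Cauchy_Schwarz[of f h'] by simp
  also have "\<dots> \<le> ((class_deg y)\<^sup>2 * A) * (q * ((deg r)\<^sup>2 * A))"
    using fb hb ip_nonneg A by (intro mult_mono) auto
  also have "\<dots> = q * (class_deg y * (deg r * A))\<^sup>2" by (simp add: power2_eq_square mult_ac)
  finally have "\<bar>class_deg y * (law (2 * T + t) y - m)\<bar> \<le> sqrt q * (class_deg y * (deg r * A))"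
    using q dr A class_deg_ge_1[OF y] by (intro sqrt_pow_mult_cancel) auto
  then have "class_deg y * \<bar>law (2 * T + t) y - m\<bar> \<le> class_deg y * (sqrt q * (deg r * A))"
    using class_deg_ge_1[OF y] by (simp add: abs_mult mult_ac)
  then have "\<bar>law (2 * T + t) y - m\<bar> \<le> sqrt q * (deg r * A)"
    using class_deg_ge_1[OF y] by simp
  then have "vol / deg r * \<bar>law (2 * T + t) y - m\<bar> \<le> vol / deg r * (sqrt q * (deg r * A))"
    using v dr by (intro mult_left_mono) auto
  moreover have "vol * law (2 * T + t) y / deg r - 1 = vol / deg r * (law (2 * T + t) y - m)"
    using v dr by (simp add: m_def field_simps)
  ultimately show ?thesis using v dr by (simp add: abs_mult q_def A_def mult_ac)
qed

end

end

section \<open>Distances and quasi-isometries\<close>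

lemma graph_dist_le_length:
  assumes "pair_graph G" "pre_digraph.awalk (with_proj G) u p v"
  shows "graph_dist G u v \<le> length p"
proof -
  interpret pair_graph G by fact
  have "\<mu> (\<lambda>_. 1) u v \<le> ereal (awalk_cost (\<lambda>_. 1) p)"
    using assms(2) by (rule min_cost_le_walk_cost)
  also have "awalk_cost (\<lambda>_. 1) p = length p" by (simp add: awalk_cost_def sum_list_triv)
  finally have le: "\<mu> (\<lambda>_. 1) u v \<le> ereal (length p)" .
  show ?thesis
  proof (cases "\<mu> (\<lambda>_. 1) u v")
    case (real x)
    then show ?thesis using le by (simp add: graph_dist_def)
  qed (use le in \<open>simp_all add: graph_dist_def\<close>)
qed

lemma graph_dist_walkE:
  assumes "pair_graph G" "Digraph_Component.connected (with_proj G)" "u \<in> pverts G" "v \<in> pverts G"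
  obtains p where "pre_digraph.awalk (with_proj G) u p v" "graph_dist G u v = length p"
proof -
  interpret pair_graph G by fact
  have "strongly_connected (with_proj G)"
    using assms(2) sym_arcs by (intro symmetric_connected_imp_strongly_connected)
  then have "reachable (with_proj G) u v" using assms(3,4) by (auto simp: strongly_connected_def)
  then obtain p where p: "apath u p v" "\<mu> (\<lambda>_. 1) u v = awalk_cost (\<lambda>_. 1) p"
    using min_cost_awalk[of u v "\<lambda>_. 1"] by auto
  have "awalk_cost (\<lambda>_. 1) p = length p" by (simp add: awalk_cost_def sum_list_triv)
  then show ?thesis using p that[of p] by (simp add: graph_dist_def apath_def)
qed

lemma graph_dist_stretch:
  assumes G: "pair_graph G" "Digraph_Component.connected (with_proj G)" and H: "pair_graph H"
    and verts: "pverts G = pverts H"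
    and replace: "\<And>u v. (u, v) \<in> parcs G \<Longrightarrow> \<exists>p. pre_digraph.awalk (with_proj H) u p v \<and> length p \<le> k"
    and uv: "u \<in> pverts G" "v \<in> pverts G"
  shows "graph_dist H u v \<le> real k * graph_dist G u v"
proof -
  interpret G: pair_graph G by fact
  interpret H: pair_graph H by fact
  obtain p where p: "G.awalk u p v" "graph_dist G u v = length p"
    using graph_dist_walkE[OF G uv] .
  have "\<exists>q. H.awalk u q v \<and> length q \<le> k * length p"
    using p(1)
  proof (induction p arbitrary: u)
    case Nil
    then show ?case using verts by (auto simp: G.awalk_Nil_iff H.awalk_Nil_iff)
  next
    case (Cons e p)
    then have e: "e \<in> parcs G" "fst e = u" "G.awalk (snd e) p v"
      by (auto simp: G.awalk_Cons_iff)
    obtain q where q: "H.awalk (snd e) q v" "length q \<le> k * length p" using Cons.IH[OF e(3)] by blast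
    obtain s where s: "H.awalk u s (snd e)" "length s \<le> k"
      using replace[of u "snd e"] e by (metis prod.collapse)
    have "H.awalk u (s @ q) v" using s q by (intro H.awalk_appendI)
    then show ?case using s q by (intro exI[of _ "s @ q"]) auto
  qed
  then obtain q where q: "H.awalk u q v" "length q \<le> k * length p" by blast
  have "graph_dist H u v \<le> length q" by (rule graph_dist_le_length[OF H q(1)])
  also have "\<dots> \<le> real k * length p" using q(2) by (metis of_nat_mono of_nat_mult)
  finally show ?thesis using p by simp
qed

lemma quasi_isometry_of_subgraph:
  assumes G: "pair_graph G" "Digraph_Component.connected (with_proj G)"
    and H: "pair_graph H" "Digraph_Component.connected (with_proj H)"
    and verts: "pverts G = pverts H" and sub: "parcs H \<subseteq> parcs G"
    and replace: "\<And>u v. (u, v) \<in> parcs G \<Longrightarrow> \<exists>p. pre_digraph.awalk (with_proj H) u p v \<and> length p \<le> 2"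
  shows "quasi_isometry 2 0 (pverts G) (graph_dist G) (pverts H) (graph_dist H) id"
proof -
  interpret G: pair_graph G by fact
  interpret H: pair_graph H by fact
  have "graph_dist H u v \<le> 2 * graph_dist G u v" if "u \<in> pverts G" "v \<in> pverts G" for u v
    using graph_dist_stretch[OF G H(1) verts replace that] by simp
  moreover have "graph_dist G u v \<le> graph_dist H u v" if uv: "u \<in> pverts G" "v \<in> pverts G" for u v
  proof -
    have "graph_dist G u v \<le> real 1 * graph_dist H u v"
    proof (rule graph_dist_stretch[OF H G(1) verts[symmetric]])
      fix a b assume "(a, b) \<in> parcs H"
      then have "G.awalk a [(a, b)] b" using sub G.wellformed' by (auto simp: G.awalk_simps)
      then show "\<exists>p. G.awalk a p b \<and> length p \<le> 1" by (intro exI[of _ "[(a, b)]"]) auto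
    qed (use uv verts in auto)
    then show ?thesis by simp
  qed
  moreover have nn: "0 \<le> graph_dist G u v" if "u \<in> pverts G" "v \<in> pverts G" for u v
    using graph_dist_walkE[OF G that] by (metis of_nat_0_le_iff)
  moreover have "graph_dist H y y \<le> 2" if "y \<in> pverts H" for y
    using graph_dist_le_length[OF H(1), of y "[]" y] that by (simp add: H.awalk_Nil_iff)
  ultimately show ?thesis unfolding quasi_isometry_def using verts
    by (fastforce intro: order_trans[OF _ mult_right_mono[of 1 2]])
qed

section \<open>Mixing distances\<close>

lemma mixing_time_le: "mixing_dist p G x t < \<epsilon> \<Longrightarrow> mixing_time p \<epsilon> G x \<le> ereal (real t)"
  unfolding mixing_time_def by (rule INF_lower2) auto

lemma le_mixing_time:
  assumes "\<And>t. real t < T \<Longrightarrow> \<epsilon> \<le> mixing_dist p G x t"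
  shows "ereal T \<le> mixing_time p \<epsilon> G x"
  unfolding mixing_time_def using assms by (intro INF_greatest) (force simp: not_less)

context
  fixes G :: "'a pair_pre_digraph"
  assumes fin: "finite (pverts G)" and ne: "pverts G \<noteq> {}"
    and stat_pos: "\<And>y. y \<in> pverts G \<Longrightarrow> stationary G y > 0"
begin

lemma stationary_sum: "(\<Sum>y\<in>pverts G. stationary G y) = 1"
proof -
  obtain y where y: "y \<in> pverts G" using ne by blast
  have "(\<Sum>z\<in>pverts G. real (vertex_degree G z)) \<noteq> 0"
    using stat_pos[OF y] by (auto simp: stationary_def)
  then show ?thesis unfolding stationary_def sum_divide_distrib[symmetric] by simp
qed

lemma TV_le_Ell_2: "mixing_dist TV G x t \<le> mixing_dist Ell_2 G x t"
proof -
  let ?h = "\<lambda>y. \<bar>pmf (srw G x t) y / stationary G y - 1\<bar>"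
  have 1: "(\<Sum>y\<in>pverts G. \<bar>pmf (srw G x t) y - stationary G y\<bar>) = (\<Sum>y\<in>pverts G. stationary G y * ?h y)"
  proof (intro sum.cong refl)
    fix y assume y: "y \<in> pverts G"
    have "stationary G y * ?h y = \<bar>stationary G y * (pmf (srw G x t) y / stationary G y - 1)\<bar>"
      using stat_pos[OF y] by (simp add: abs_mult)
    also have "\<dots> = \<bar>pmf (srw G x t) y - stationary G y\<bar>"
      using stat_pos[OF y] by (simp add: right_diff_distrib)
    finally show "\<bar>pmf (srw G x t) y - stationary G y\<bar> = stationary G y * ?h y" by simp
  qed
  have "(\<Sum>y\<in>pverts G. stationary G y * ?h y)\<^sup>2
      = (\<Sum>y\<in>pverts G. sqrt (stationary G y) * (sqrt (stationary G y) * ?h y))\<^sup>2"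
    using stat_pos by (intro arg_cong2[where f = power] refl sum.cong) (simp add: mult.assoc[symmetric] less_imp_le)
  also have "\<dots> \<le> (\<Sum>y\<in>pverts G. (sqrt (stationary G y))\<^sup>2) * (\<Sum>y\<in>pverts G. (sqrt (stationary G y) * ?h y)\<^sup>2)"
    by (rule Cauchy_Schwarz_ineq_sum)
  also have "(\<Sum>y\<in>pverts G. (sqrt (stationary G y))\<^sup>2) = 1"
    using stat_pos stationary_sum by (simp add: less_imp_le)
  also have "(\<Sum>y\<in>pverts G. (sqrt (stationary G y) * ?h y)\<^sup>2) = (\<Sum>y\<in>pverts G. stationary G y * (?h y)\<^sup>2)"
    using stat_pos by (intro sum.cong refl) (simp add: power_mult_distrib less_imp_le)
  finally have "(\<Sum>y\<in>pverts G. stationary G y * ?h y) \<le> mixing_dist Ell_2 G x t"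
    by (simp add: real_le_rsqrt)
  moreover have "0 \<le> (\<Sum>y\<in>pverts G. stationary G y * ?h y)"
    using stat_pos by (intro sum_nonneg) (simp add: less_imp_le)
  ultimately show ?thesis unfolding mixing_dist.simps(1) 1 by linarith
qed

lemma Ell_2_le_Ell_infinity: "mixing_dist Ell_2 G x t \<le> mixing_dist Ell_infinity G x t"
proof -
  let ?h = "\<lambda>y. \<bar>pmf (srw G x t) y / stationary G y - 1\<bar>"
  define M where "M = Max (?h ` pverts G)"
  have M: "?h y \<le> M" if "y \<in> pverts G" for y using fin that by (auto simp: M_def)
  have M0: "M \<ge> 0" using ne M by (meson abs_ge_zero ex_in_conv order_trans)
  have "(\<Sum>y\<in>pverts G. stationary G y * (?h y)\<^sup>2) \<le> (\<Sum>y\<in>pverts G. stationary G y * M\<^sup>2)"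
    using stat_pos M by (intro sum_mono mult_left_mono power_mono) (auto simp: less_imp_le)
  also have "\<dots> = M\<^sup>2" using stationary_sum by (simp add: sum_distrib_right[symmetric])
  finally show ?thesis using M0 by (simp add: M_def real_le_lsqrt)
qed

lemma TV_le: "mixing_dist TV G x t \<le> mixing_dist p G x t"
  using TV_le_Ell_2[of x t] Ell_2_le_Ell_infinity[of x t] by (cases p) (auto intro: order_trans)

lemma le_Ell_infinity: "mixing_dist p G x t \<le> mixing_dist Ell_infinity G x t"
  using TV_le_Ell_2[of x t] Ell_2_le_Ell_infinity[of x t] by (cases p) (auto intro: order_trans)

text \<open>An event that the walk avoids although its stationary mass is large.\<close>
lemma TV_ge_event:
  assumes B: "B \<subseteq> pverts G"
    and pB: "(\<Sum>y\<in>B. pmf (srw G x t) y) \<le> a" and sB: "(\<Sum>y\<in>pverts G - B. stationary G y) \<le> b"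
    and total: "set_pmf (srw G x t) \<subseteq> pverts G"
  shows "mixing_dist TV G x t \<ge> 1 - a - b"
proof -
  let ?p = "pmf (srw G x t)"
  have fB: "finite B" using B fin finite_subset by blast
  have tp: "(\<Sum>y\<in>pverts G. ?p y) = 1" using fin total by (rule sum_pmf_eq_1)
  have split: "(\<Sum>y\<in>pverts G. f y) = (\<Sum>y\<in>B. f y) + (\<Sum>y\<in>pverts G - B. f y)" for f :: "'a \<Rightarrow> real"
    using sum.subset_diff[OF B fin, of f] by simp
  have "(\<Sum>y\<in>B. stationary G y - ?p y) \<le> (\<Sum>y\<in>B. \<bar>?p y - stationary G y\<bar>)"
    by (intro sum_mono) auto
  moreover have "(\<Sum>y\<in>pverts G - B. ?p y - stationary G y) \<le> (\<Sum>y\<in>pverts G - B. \<bar>?p y - stationary G y\<bar>)"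
    by (intro sum_mono) auto
  ultimately show ?thesis
    using split[of "\<lambda>y. \<bar>?p y - stationary G y\<bar>"] split[of ?p] split[of "stationary G"] tp stationary_sum pB sB
    by (simp add: sum_subtractf)
qed

end

lemma card_support_srw:
  assumes "\<And>x. x \<in> pverts G \<Longrightarrow> card {z. (x, z) \<in> parcs G} \<le> D"
    and "\<And>x. x \<in> pverts G \<Longrightarrow> {z. (x, z) \<in> parcs G} \<noteq> {}"
    and "parcs G \<subseteq> pverts G \<times> pverts G" "finite (pverts G)" "x \<in> pverts G"
  shows "set_pmf (srw G x t) \<subseteq> pverts G \<and> card (set_pmf (srw G x t)) \<le> D ^ t"
proof (induction t)
  case 0
  then show ?case using assms(5) by simp
next
  case (Suc t)
  let ?N = "\<lambda>y. {z. (y, z) \<in> parcs G}"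
  have f: "finite (?N y)" for y
    by (rule finite_subset[OF _ assms(4)]) (use assms(3) in auto)
  have "set_pmf (pmf_of_set (?N y)) = ?N y" if "y \<in> set_pmf (srw G x t)" for y
    using Suc assms(2)[of y] f[of y] that by (intro set_pmf_of_set) blast+
  then have s: "set_pmf (srw G x (Suc t)) = (\<Union>y\<in>set_pmf (srw G x t). ?N y)" by simp
  have fin: "finite (set_pmf (srw G x t))" using Suc assms(4) finite_subset by blast
  have "card (set_pmf (srw G x (Suc t))) \<le> (\<Sum>y\<in>set_pmf (srw G x t). card (?N y))"
    unfolding s by (rule card_UN_le[OF fin])
  also have "\<dots> \<le> (\<Sum>y\<in>set_pmf (srw G x t). D)" using Suc assms(1) by (intro sum_mono) blast
  also have "\<dots> \<le> D ^ t * D" using Suc by (simp add: mult_right_mono)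
  finally show ?case using s assms(3) Suc by (auto simp: mult.commute)
qed

text \<open>The vertices of the final graphs are natural numbers, while words are the natural vertices here.\<close>
definition encode_graph :: "('v::countable) set \<Rightarrow> ('v \<Rightarrow> 'v set) \<Rightarrow> nat pair_pre_digraph" where
  "encode_graph V N = \<lparr>pverts = to_nat ` V, parcs = {(to_nat x, to_nat y) |x y. x \<in> V \<and> y \<in> N x}\<rparr>"

lemma pverts_encode [simp]: "pverts (encode_graph V N) = to_nat ` V"
  by (simp add: encode_graph_def)

lemma to_nat_inj [simp]: "inj_on to_nat A"
  by (rule inj_on_subset[OF inj_to_nat]) auto

text \<open>Connectedness is witnessed by a rank that decreases along some edge at each vertex but the root.\<close>
locale rooted_walk = lumped_walk V N cls r D
  for V :: "'v::countable set" and N and cls :: "'v \<Rightarrow> 'c" and r and D +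
  fixes rank :: "'v \<Rightarrow> nat"
  assumes descend: "x \<in> V \<Longrightarrow> x \<noteq> r \<Longrightarrow> \<exists>y\<in>N x. rank y < rank x"
begin

abbreviation "encoded \<equiv> encode_graph V N"

lemma arcs_from: "x \<in> V \<Longrightarrow> {z. (to_nat x, z) \<in> parcs encoded} = to_nat ` N x"
  by (auto simp: encode_graph_def)

lemma arc_iff: "x \<in> V \<Longrightarrow> (to_nat x, to_nat y) \<in> parcs encoded \<longleftrightarrow> y \<in> N x"
  by (auto simp: encode_graph_def)

lemma parcs_sub: "parcs encoded \<subseteq> pverts encoded \<times> pverts encoded"
  unfolding encode_graph_def using nbr_in_V by fastforce

lemma pair_graph_encode: "pair_graph encoded"
proof
  show "finite (pverts encoded)" using finite_V by simp
  show "finite (parcs encoded)"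
    by (rule finite_subset[OF parcs_sub]) (use finite_V in simp)
  show "symmetric (with_proj encoded)"
    unfolding symmetric_def
  proof (rule symI)
    fix a b assume "(a, b) \<in> arcs_ends (with_proj encoded)"
    then obtain x y where "a = to_nat x" "b = to_nat y" "x \<in> V" "y \<in> N x"
      by (auto simp: encode_graph_def)
    then show "(b, a) \<in> arcs_ends (with_proj encoded)"
      using nbr_sym[of x y] nbr_in_V[of x y] by (auto simp: encode_graph_def)
  qed
  fix e assume "e \<in> parcs encoded"
  then show "fst e \<in> pverts encoded" "snd e \<in> pverts encoded" "fst e \<noteq> snd e"
    using nbr_in_V nbr_irrefl by (auto simp: encode_graph_def)
qed

sublocale PG: pair_graph encoded by (rule pair_graph_encode)

lemma connected_encode: "Digraph_Component.connected (with_proj encoded)"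
proof -
  have reach: "reachable (with_proj encoded) (to_nat x) (to_nat r)" if "x \<in> V" for x
    using that
  proof (induction "rank x" arbitrary: x rule: less_induct)
    case less
    show ?case
    proof (cases "x = r")
      case True
      then show ?thesis using less.prems PG.reachable_refl[of "to_nat x"] by simp
    next
      case False
      then obtain y where y: "y \<in> N x" "rank y < rank x" using descend less.prems by blast
      have yr: "reachable (with_proj encoded) (to_nat y) (to_nat r)"
        using less.hyps[OF y(2)] nbr_in_V[OF less.prems y(1)] .
      have "(to_nat x, to_nat y) \<in> parcs encoded" using y less.prems by (simp add: arc_iff)
      then show ?thesis using yr by (rule PG.adj_reachable_trans)
    qed
  qed
  have "reachable (with_proj encoded) (to_nat x) (to_nat y)" if "x \<in> V" "y \<in> V" for x y
    by (rule PG.reachable_trans[OF reach[OF that(1)] symmetric_reachable[OF PG.sym_arcs reach[OF that(2)]]])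
  then show ?thesis
    using root PG.reachable_mk_symmetricI by (intro PG.connectedI) auto
qed

lemma finite_connected_rooted_encode: "finite_connected_rooted_graph encoded (to_nat r)"
  unfolding finite_connected_rooted_graph_def
  using pair_graph_encode connected_encode root by auto

lemma vertex_degree_encode: "x \<in> V \<Longrightarrow> real (vertex_degree encoded (to_nat x)) = deg x"
proof -
  assume x: "x \<in> V"
  have "out_arcs (with_proj encoded) (to_nat x) = Pair (to_nat x) ` {z. (to_nat x, z) \<in> parcs encoded}"
    by (auto simp: out_arcs_def)
  then have "vertex_degree encoded (to_nat x) = card (Pair (to_nat x) ` to_nat ` N x)"
    unfolding vertex_degree_def out_degree_def using arcs_from[OF x] by simp
  also have "\<dots> = card (N x)" by (simp add: card_image inj_on_def)
  finally show ?thesis by (simp add: deg_def)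
qed

lemma stationary_encode: "y \<in> V \<Longrightarrow> stationary encoded (to_nat y) = deg y / vol"
  unfolding stationary_def by (simp add: vertex_degree_encode sum.reindex vol_def)

lemma stationary_pos: "y \<in> pverts encoded \<Longrightarrow> stationary encoded y > 0"
  using deg_pos vol_pos by (auto simp: stationary_encode)

lemma finite_verts_encode: "finite (pverts encoded)" and verts_nonempty: "pverts encoded \<noteq> {}"
  using finite_V root by auto

lemma support_srw: "set_pmf (srw encoded (to_nat r) t) \<subseteq> pverts encoded"
    "real (card (set_pmf (srw encoded (to_nat r) t))) \<le> D ^ t"
proof -
  have "card (N x) \<le> nat \<lfloor>D\<rfloor>" if "x \<in> V" for x
    using deg_le[OF that] by (simp add: deg_def le_nat_floor)
  then have *: "set_pmf (srw encoded (to_nat r) t) \<subseteq> pverts encoded \<and> card (set_pmf (srw encoded (to_nat r) t)) \<le> nat \<lfloor>D\<rfloor> ^ t"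
    using finite_V root parcs_sub
    by (intro card_support_srw) (auto simp: arcs_from[unfolded set_eq_iff mem_Collect_eq] arcs_from card_image nbr_nonempty)
  then show "set_pmf (srw encoded (to_nat r) t) \<subseteq> pverts encoded" by simp
  have "real (card (set_pmf (srw encoded (to_nat r) t))) \<le> real (nat \<lfloor>D\<rfloor> ^ t)"
    using * by (intro of_nat_mono) simp
  also have "\<dots> = real (nat \<lfloor>D\<rfloor>) ^ t" by simp
  also have "\<dots> \<le> D ^ t" using D_ge_1 by (intro power_mono) auto
  finally show "real (card (set_pmf (srw encoded (to_nat r) t))) \<le> D ^ t" .
qed

lemma pmf_srw: "y \<in> V \<Longrightarrow> pmf (srw encoded (to_nat r) t) (to_nat y) = deg y * law t y / deg r"
proof (induction t arbitrary: y)
  case 0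
  then show ?case using deg_pos[OF root] by (auto simp: law_def indicator_def)
next
  case (Suc t)
  let ?p = "srw encoded (to_nat r) t"
  have "pmf (srw encoded (to_nat r) (Suc t)) (to_nat y)
      = (\<Sum>x\<in>pverts encoded. pmf (pmf_of_set {z. (x, z) \<in> parcs encoded}) (to_nat y) * pmf ?p x)"
    using support_srw(1) finite_verts_encode
    by (simp add: pmf_bind) (subst integral_measure_pmf[of "pverts encoded"], auto simp: mult.commute)
  also have "\<dots> = (\<Sum>x\<in>V. pmf (pmf_of_set (to_nat ` N x)) (to_nat y) * pmf ?p (to_nat x))"
    by (simp add: sum.reindex arcs_from)
  also have "\<dots> = (\<Sum>x\<in>V. if x \<in> N y then law t x / deg r else 0)"
  proof (intro sum.cong refl)
    fix x assume x: "x \<in> V"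
    have "pmf (pmf_of_set (to_nat ` N x)) (to_nat y) = (if y \<in> N x then 1 / deg x else 0)"
      using x nbr_nonempty finite_nbr by (auto simp: card_image deg_def indicator_def)
    moreover have "y \<in> N x \<longleftrightarrow> x \<in> N y" using nbr_sym x Suc.prems by blast
    ultimately show "pmf (pmf_of_set (to_nat ` N x)) (to_nat y) * pmf ?p (to_nat x)
        = (if x \<in> N y then law t x / deg r else 0)"
      using Suc.IH[OF x] deg_pos[OF x] by simp
  qed
  also have "\<dots> = (\<Sum>x\<in>N y. law t x / deg r)"
    using finite_V nbr_subset[OF Suc.prems] by (simp add: sum.If_cases Int_absorb1)
  also have "\<dots> = (deg y * law (Suc t) y) / deg r"
    using deg_avg[OF Suc.prems, of "law t"] by (simp add: law_def sum_divide_distrib)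
  finally show ?case .
qed

lemma density_encode:
  "y \<in> V \<Longrightarrow> pmf (srw encoded (to_nat r) t) (to_nat y) / stationary encoded (to_nat y) = vol * law t y / deg r"
  using deg_pos[of y] by (simp add: pmf_srw stationary_encode)

lemma mixing_dist_le:
  assumes "\<And>y. y \<in> V \<Longrightarrow> \<bar>vol * law t y / deg r - 1\<bar> \<le> B"
  shows "mixing_dist p encoded (to_nat r) t \<le> B"
proof -
  have "mixing_dist p encoded (to_nat r) t \<le> mixing_dist Ell_infinity encoded (to_nat r) t"
    by (rule le_Ell_infinity[OF finite_verts_encode verts_nonempty stationary_pos])
  also have "\<dots> \<le> B"
    using finite_V verts_nonempty assms by (simp add: density_encode)
  finally show ?thesis .
qed

lemma prob_event:
  assumes B: "B \<subseteq> V"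
  shows "(\<Sum>y\<in>to_nat ` B. pmf (srw encoded (to_nat r) t) y) = (avg ^^ t) (indicator B) r"
proof -
  have "(\<Sum>y\<in>to_nat ` B. pmf (srw encoded (to_nat r) t) y) = (\<Sum>y\<in>B. deg y * law t y) / deg r"
    using B by (auto simp: sum.reindex sum_divide_distrib intro!: sum.cong pmf_srw)
  also have "(\<Sum>y\<in>B. deg y * law t y) = ip (indicator B) (law t)" by (rule ip_indicator[OF B, symmetric])
  also have "\<dots> = ip (indicator {r}) ((avg ^^ t) (indicator B))"
    unfolding law_def by (metis ip_funpow_sym ip_commute)
  also have "\<dots> = deg r * (avg ^^ t) (indicator B) r"
    using root by (subst ip_indicator) auto
  finally show ?thesis using deg_pos[OF root] by simp
qed

lemma mixing_dist_ge:
  assumes "B \<subseteq> V" "(avg ^^ t) (indicator B) r \<le> a" "real (card (V - B)) * D \<le> b * vol"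
  shows "1 - a - b \<le> mixing_dist p encoded (to_nat r) t"
proof -
  have v: "vol > 0" using vol_pos root by blast
  have "(\<Sum>y\<in>to_nat ` V - to_nat ` B. stationary encoded y) = (\<Sum>y\<in>to_nat ` (V - B). stationary encoded y)"
    by (simp add: inj_on_image_set_diff[OF to_nat_inj[of UNIV]])
  also have "\<dots> = (\<Sum>y\<in>V - B. deg y / vol)"
    by (auto simp: sum.reindex stationary_encode intro!: sum.cong)
  also have "\<dots> \<le> (\<Sum>y\<in>V - B. D / vol)"
    using deg_le v by (intro sum_mono divide_right_mono) auto
  also have "\<dots> = real (card (V - B)) * D / vol" by simp
  also have "\<dots> \<le> b" using assms(3) v by (simp add: divide_le_eq)
  finally have sB: "(\<Sum>y\<in>pverts encoded - to_nat ` B. stationary encoded y) \<le> b" by simp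
  have "1 - a - b \<le> mixing_dist TV encoded (to_nat r) t"
    using assms(1,2) prob_event[OF assms(1), of t] support_srw(1) sB
    by (intro TV_ge_event[of encoded "to_nat ` B", OF finite_verts_encode verts_nonempty stationary_pos]) auto
  also have "\<dots> \<le> mixing_dist p encoded (to_nat r) t"
    by (rule TV_le[OF finite_verts_encode verts_nonempty stationary_pos])
  finally show ?thesis .
qed

lemma mixing_dist_ge_support:
  assumes "2 * D ^ Suc t \<le> vol"
  shows "1 / 2 \<le> mixing_dist p encoded (to_nat r) t"
proof -
  define S where "S = {y\<in>V. to_nat y \<in> set_pmf (srw encoded (to_nat r) t)}"
  have "to_nat ` S \<subseteq> set_pmf (srw encoded (to_nat r) t)" by (auto simp: S_def)
  then have "card (to_nat ` S) \<le> card (set_pmf (srw encoded (to_nat r) t))"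
    by (rule card_mono[rotated]) (metis finite_subset support_srw(1) finite_verts_encode)
  then have "real (card S) \<le> D ^ t" using support_srw(2)[of t] by (simp add: card_image)
  then have "real (card S) * D \<le> D ^ t * D" using D_ge_1 by (intro mult_right_mono) auto
  also have "\<dots> \<le> 1 / 2 * vol" using assms by (simp add: mult_ac)
  finally have c: "real (card (V - (V - S))) * D \<le> 1 / 2 * vol"
    by (simp add: S_def double_diff)
  have "(avg ^^ t) (indicator (V - S)) r = (\<Sum>y\<in>to_nat ` (V - S). pmf (srw encoded (to_nat r) t) y)"
    by (rule prob_event[symmetric]) auto
  also have "\<dots> = 0" by (intro sum.neutral) (auto simp: S_def set_pmf_iff)
  finally have "1 - 0 - 1 / 2 \<le> mixing_dist p encoded (to_nat r) t"
    using c by (intro mixing_dist_ge[of "V - S"]) auto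
  then show ?thesis by simp
qed

end

section \<open>The two graphs\<close>

type_synonym vertex = "nat list \<times> bool list"

text \<open>Half of the 20 symbols are favoured, and \<open>flip\<close> preserves both halves.\<close>
definition favoured :: "nat \<Rightarrow> bool" where "favoured x \<longleftrightarrow> x < 10"

definition flip :: "nat \<Rightarrow> nat" where "flip x = (if even x then x + 1 else x - 1)"

text \<open>
  The edges between a letter and a symbol that may be exchanged for it. In the biased graph an
  unfavoured symbol is linked to the letter given by its parity only, and its flip is linked to
  the other one.
\<close>
definition linked :: "bool \<Rightarrow> nat \<Rightarrow> bool \<Rightarrow> bool" where
  "linked b x c \<longleftrightarrow> (b \<longrightarrow> favoured x \<or> c = odd x)"

lemma flip_less: "x < 20 \<Longrightarrow> flip x < 20"
  unfolding flip_def by presburger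

lemma flip_flip: "flip (flip x) = x"
  by (auto simp: flip_def elim: oddE)

lemma flip_neq: "flip x \<noteq> x"
  by (auto simp: flip_def elim: oddE)

lemma odd_flip: "odd (flip x) \<longleftrightarrow> even x"
  by (auto simp: flip_def)

lemma favoured_flip: "favoured (flip x) = favoured x"
  unfolding flip_def favoured_def by presburger

lemma symbol_set: "{..<20} = {0,1,2,3,4,5,6,7,8,9,10,11,12,13,14,15,16,17,18,19::nat}"
  by (simp add: lessThan_nat_numeral lessThan_Suc insert_commute)

lemma sum_linked:
  "(\<Sum>x | x < 20 \<and> linked b x c. f (favoured x)) = 10 * f True + (if b then 5 else 10) * (f False :: real)"
proof -
  have "(\<Sum>x | x < 20 \<and> linked b x c. f (favoured x)) = (\<Sum>x\<in>{..<20}. if linked b x c then f (favoured x) else 0)"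
    by (subst sum.inter_filter[symmetric]) (auto intro: sum.cong)
  also have "\<dots> = 10 * f True + (if b then 5 else 10) * f False"
    unfolding symbol_set by (cases b; cases c) (simp_all add: linked_def favoured_def)
  finally show ?thesis .
qed

text \<open>
  Words grow at the head. If \<open>xs\<close> has at least \<open>h\<close> symbols, then the truncated
  difference forces \<open>cs\<close> to be empty: these are the vertices of the traps. The words without
  symbols form the binary tree at the root.
\<close>
definition layer_verts :: "nat \<Rightarrow> nat \<Rightarrow> vertex set" where
  "layer_verts h m = {(xs, cs). set xs \<subseteq> {..<20} \<and> length xs \<le> h + m \<and>
     (xs = [] \<and> length cs \<le> h \<or> length cs = h - length xs)}"

fun kids :: "bool \<Rightarrow> nat \<Rightarrow> nat \<Rightarrow> vertex \<Rightarrow> vertex set" where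
  "kids b h m (xs, cs) =
     (if xs = [] \<and> length cs < h then (\<lambda>c. ([], c # cs)) ` UNIV
      else if length xs < h then (\<lambda>x. (x # xs, tl cs)) ` {x. x < 20 \<and> linked b x (hd cs)}
      else if length xs < h + m then (\<lambda>x. (x # xs, [])) ` {..<20} else {})"

fun parents :: "bool \<Rightarrow> nat \<Rightarrow> vertex \<Rightarrow> vertex set" where
  "parents b h (xs, cs) =
     (if xs = [] then (if cs = [] then {} else {([], tl cs)})
      else if length xs \<le> h then (\<lambda>c. (tl xs, c # cs)) ` {c. linked b (hd xs) c}
      else {(tl xs, [])})"

fun twins :: "vertex \<Rightarrow> vertex set" where
  "twins (xs, cs) =
     (if xs \<noteq> [] then {(flip (hd xs) # tl xs, cs)}
      else if cs \<noteq> [] then {([], (\<not> hd cs) # tl cs)} else {})"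

definition nbrs :: "bool \<Rightarrow> nat \<Rightarrow> nat \<Rightarrow> vertex \<Rightarrow> vertex set" where
  "nbrs b h m v = kids b h m v \<union> parents b h v \<union> twins v"

text \<open>
  This is not the distance to the root: steps inside the traps, which only remove a symbol and do not add a
  letter, count twice. It decreases along inward steps, by at most 2.
\<close>
fun height :: "vertex \<Rightarrow> nat" where "height (xs, cs) = 2 * length xs + length cs"

text \<open>
  In a trap only its root, the last \<open>h\<close> symbols, counts.
\<close>
fun flags :: "nat \<Rightarrow> vertex \<Rightarrow> bool list" where
  "flags h (xs, cs) = map favoured (drop (length xs - h) xs)"

fun vclass :: "bool \<Rightarrow> nat \<Rightarrow> vertex \<Rightarrow> bool list \<times> nat \<times> nat" where
  "vclass b h (xs, cs) = (if b then flags h (xs, cs) else [], length xs, length cs)"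

text \<open>
  The sum of \<open>F\<close> over the neighbours of a vertex, computed on the classes: outward steps,
  inward steps, and the twin. In the biased graph a vertex of the middle part has 10 outward edges to favoured
  symbols and 5 to unfavoured ones.
\<close>
definition class_nbr_sum ::
  "bool \<Rightarrow> nat \<Rightarrow> nat \<Rightarrow> (bool list \<times> nat \<times> nat \<Rightarrow> real) \<Rightarrow> bool list \<times> nat \<times> nat \<Rightarrow> real" where
  "class_nbr_sum b h m F = (\<lambda>(fl, i, j).
     (if i = 0 \<and> j < h then 2 * F (fl, 0, j + 1)
      else if i < h then (if b then 10 * F (True # fl, i + 1, j - 1) + 5 * F (False # fl, i + 1, j - 1)
        else 20 * F (fl, i + 1, j - 1))
      else if i < h + m then 20 * F (fl, i + 1, 0) else 0) +
     (if i = 0 then (if j = 0 then 0 else F (fl, 0, j - 1))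
      else if i \<le> h then (if b \<and> \<not> hd fl then 1 else 2) * F (tl fl, i - 1, j + 1)
      else F (fl, i - 1, 0)) +
     (if i = 0 \<and> j = 0 then 0 else F (fl, i, j)))"

context
  fixes b :: bool and h m :: nat
  assumes h: "h \<ge> 1" and m: "m \<ge> 1"
begin

lemma finite_layer_verts: "finite (layer_verts h m)"
proof (rule finite_subset)
  show "layer_verts h m \<subseteq> {xs. set xs \<subseteq> {..<20} \<and> length xs \<le> h + m} \<times> {cs. set cs \<subseteq> UNIV \<and> length cs \<le> h}"
    by (auto simp: layer_verts_def)
  show "finite ({xs::nat list. set xs \<subseteq> {..<20} \<and> length xs \<le> h + m} \<times> {cs::bool list. set cs \<subseteq> UNIV \<and> length cs \<le> h})"
    by (intro finite_cartesian_product finite_lists_length_le) auto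
qed

lemma kids_parents:
  assumes "v \<in> layer_verts h m" "w \<in> kids b h m v"
  shows "w \<in> layer_verts h m" "v \<in> parents b h w" "height v < height w"
proof -
  obtain xs cs where v: "v = (xs, cs)" by (cases v)
  consider (tree) "xs = []" "length cs < h" | (fat) c ds where "length xs < h" "length cs = h - length xs" "cs = c # ds"
    | (trap) "length xs \<ge> h" "cs = []"
  proof (cases "length xs < h")
    case True
    show ?thesis
    proof (cases "xs = [] \<and> length cs < h")
      case False
      then have "length cs = h - length xs" using assms(1) True by (auto simp: v layer_verts_def)
      then show ?thesis using True that(2) by (cases cs) auto
    qed (use that in auto)
  next
    case False
    then show ?thesis using assms(1) h that by (auto simp: v layer_verts_def)
  qed
  then have "w \<in> layer_verts h m \<and> v \<in> parents b h w \<and> height v < height w"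
  proof cases
    case tree
    then show ?thesis using assms by (auto simp: v layer_verts_def)
  next
    case fat
    then have not_tree: "\<not> (xs = [] \<and> length cs < h)" by auto
    have "kids b h m v = (\<lambda>x. (x # xs, ds)) ` {x. x < 20 \<and> linked b x c}"
      unfolding v kids.simps if_not_P[OF not_tree] if_P[OF fat(1)] unfolding fat(3) by simp
    then obtain x where "w = (x # xs, ds)" "x < 20" "linked b x c" using assms(2) by blast
    then show ?thesis using assms(1) fat by (auto simp: v layer_verts_def)
  next
    case trap
    then show ?thesis using assms h by (auto simp: v layer_verts_def split: if_splits)
  qed
  then show "w \<in> layer_verts h m" "v \<in> parents b h w" "height v < height w" by auto
qed

lemma parents_kids:
  assumes "v \<in> layer_verts h m" "w \<in> parents b h v"
  shows "w \<in> layer_verts h m" "v \<in> kids b h m w" "height w < height v"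
proof -
  obtain xs cs where v: "v = (xs, cs)" by (cases v)
  consider (tree) c ds where "xs = []" "cs = c # ds" "length cs \<le> h" | (fat) x ys where "xs = x # ys" "length xs \<le> h" "length cs = h - length xs"
    | (trap) x ys where "xs = x # ys" "length xs > h" "cs = []"
    using assms h by (cases xs; cases cs) (auto simp: v layer_verts_def split: if_splits)
  then have "w \<in> layer_verts h m \<and> v \<in> kids b h m w \<and> height w < height v"
  proof cases
    case tree
    then show ?thesis using assms by (cases c) (auto simp: v layer_verts_def)
  next
    case fat
    then show ?thesis using assms by (auto simp: v layer_verts_def)
  next
    case trap
    then show ?thesis using assms h by (auto simp: v layer_verts_def)
  qed
  then show "w \<in> layer_verts h m" "v \<in> kids b h m w" "height w < height v" by auto
qed

lemma twins_twins:
  assumes "v \<in> layer_verts h m" "w \<in> twins v"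
  shows "w \<in> layer_verts h m" "v \<in> twins w" "height w = height v" "w \<noteq> v" "vclass b h w = vclass b h v"
proof -
  obtain xs cs where v: "v = (xs, cs)" by (cases v)
  have "w \<in> layer_verts h m \<and> v \<in> twins w \<and> height w = height v \<and> w \<noteq> v \<and> vclass b h w = vclass b h v"
  proof (cases xs)
    case Nil
    then show ?thesis using assms by (cases cs) (auto simp: v layer_verts_def)
  next
    case (Cons x ys)
    then show ?thesis using assms
      by (cases "length xs - h") (auto simp: v layer_verts_def flip_less flip_flip flip_neq favoured_flip)
  qed
  then show "w \<in> layer_verts h m" "v \<in> twins w" "height w = height v" "w \<noteq> v" "vclass b h w = vclass b h v" by auto
qed

lemma parent_exists: "v \<in> layer_verts h m \<Longrightarrow> v \<noteq> ([], []) \<Longrightarrow> parents b h v \<noteq> {}"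
proof -
  have "linked b x (odd x)" for x by (simp add: linked_def)
  then show "v \<noteq> ([], []) \<Longrightarrow> parents b h v \<noteq> {}" by (cases v) auto
qed

lemma twin_exists: "v \<noteq> ([], []) \<Longrightarrow> twins v \<noteq> {}"
  by (cases v) auto

lemma kid_root: "([], [True]) \<in> kids b h m ([], [])"
  using h by auto

interpretation FW: finite_walk "layer_verts h m" "nbrs b h m"
proof
  fix x y assume x: "x \<in> layer_verts h m"
  show "nbrs b h m x \<subseteq> layer_verts h m" using kids_parents[OF x] parents_kids[OF x] twins_twins[OF x]
    by (auto simp: nbrs_def)
  show "x \<notin> nbrs b h m x" using kids_parents[OF x, of x] parents_kids[OF x, of x] twins_twins[OF x, of x]
    by (auto simp: nbrs_def)
  show "nbrs b h m x \<noteq> {}"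
    using parent_exists[OF x] kid_root by (cases "x = ([], [])") (auto simp: nbrs_def simp del: kids.simps parents.simps)
  assume "y \<in> nbrs b h m x"
  then show "x \<in> nbrs b h m y" using kids_parents[OF x, of y] parents_kids[OF x, of y] twins_twins[OF x, of y]
    by (auto simp: nbrs_def)
qed (rule finite_layer_verts)

lemma nbr_sum_class:
  assumes v: "v \<in> layer_verts h m"
  shows "(\<Sum>w\<in>nbrs b h m v. F (vclass b h w)) = class_nbr_sum b h m F (vclass b h v)"
proof -
  obtain xs cs where vx: "v = (xs, cs)" by (cases v)
  have fin: "finite (kids b h m v)" "finite (parents b h v)" "finite (twins v)"
    using FW.finite_nbr[OF v] by (auto simp: nbrs_def)
  have disj: "kids b h m v \<inter> parents b h v = {}" "(kids b h m v \<union> parents b h v) \<inter> twins v = {}"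
    using kids_parents(3)[OF v] parents_kids(3)[OF v] twins_twins(3)[OF v] by fastforce+
  have split: "(\<Sum>w\<in>nbrs b h m v. F (vclass b h w)) = (\<Sum>w\<in>kids b h m v. F (vclass b h w))
     + (\<Sum>w\<in>parents b h v. F (vclass b h w)) + (\<Sum>w\<in>twins v. F (vclass b h w))"
    unfolding nbrs_def using fin disj by (simp add: sum.union_disjoint)
  obtain fl i j where c: "vclass b h v = (fl, i, j)" by (metis prod.exhaust)
  have ij: "i = length xs" "j = length cs" "fl = (if b then flags h (xs, cs) else [])" using c by (auto simp: vx)
  have K: "(\<Sum>w\<in>kids b h m v. F (vclass b h w)) = (if i = 0 \<and> j < h then 2 * F (fl, 0, j + 1)
      else if i < h then (if b then 10 * F (True # fl, i + 1, j - 1) + 5 * F (False # fl, i + 1, j - 1)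
        else 20 * F (fl, i + 1, j - 1))
      else if i < h + m then 20 * F (fl, i + 1, 0) else 0)"
  proof -
    consider (tree) "xs = []" "length cs < h" | (fat) "\<not> (xs = [] \<and> length cs < h)" "length xs < h" 
      | (trap) "length xs \<ge> h" "length xs < h + m" | (leaf) "length xs \<ge> h + m" by linarith
    then show ?thesis
    proof cases
      case tree
      then show ?thesis by (simp add: vx ij UNIV_bool inj_on_def)
    next
      case fat
      have "(\<Sum>w\<in>kids b h m v. F (vclass b h w))
         = (\<Sum>x | x < 20 \<and> linked b x (hd cs). F (if b then favoured x # fl else fl, i + 1, j - 1))"
        using fat ij by (auto simp: vx sum.reindex inj_on_def simp del: of_nat_numeral intro!: sum.cong)
      also have "\<dots> = 10 * F (if b then True # fl else fl, i + 1, j - 1) + (if b then 5 else 10) * F (if b then False # fl else fl, i + 1, j - 1)"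
        by (rule sum_linked)
      finally show ?thesis using fat ij by auto
    next
      case trap
      have "(\<Sum>w\<in>kids b h m v. F (vclass b h w)) = (\<Sum>x\<in>{..<20::nat}. F (fl, i + 1, 0))"
        using trap h ij by (auto simp: vx sum.reindex inj_on_def Suc_diff_le intro!: sum.cong)
      moreover have "xs \<noteq> []" using trap h by auto
      ultimately show ?thesis using trap h ij by simp
    next
      case leaf
      moreover have "xs \<noteq> []" using leaf h by auto
      ultimately show ?thesis using h ij by (simp add: vx)
    qed
  qed
  have P: "(\<Sum>w\<in>parents b h v. F (vclass b h w)) = (if i = 0 then (if j = 0 then 0 else F (fl, 0, j - 1))
      else if i \<le> h then (if b \<and> \<not> hd fl then 1 else 2) * F (tl fl, i - 1, j + 1)
      else F (fl, i - 1, 0))"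
  proof (cases xs)
    case Nil
    then show ?thesis by (simp add: vx ij)
  next
    case (Cons x ys)
    show ?thesis
    proof (cases "length xs \<le> h")
      case True
      then have fl: "fl = (if b then favoured x # map favoured ys else [])" using ij Cons by simp
      have "(\<Sum>w\<in>parents b h v. F (vclass b h w)) = (\<Sum>c | linked b x c. F (tl fl, i - 1, j + 1))"
        using True Cons by (auto simp: vx sum.reindex inj_on_def fl ij intro!: sum.cong)
      also have "{c. linked b x c} = (if b \<and> \<not> favoured x then {odd x} else UNIV)"
        by (auto simp: linked_def)
      finally show ?thesis using True Cons fl ij by (simp add: UNIV_bool)
    next
      case False
      then obtain d where "length xs - h = Suc d" by (metis Suc_diff_Suc not_le)
      moreover have "length ys - h = d" using calculation Cons by simp
      ultimately show ?thesis using False Cons ij by (simp add: vx)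
    qed
  qed
  have T: "(\<Sum>w\<in>twins v. F (vclass b h w)) = (if i = 0 \<and> j = 0 then 0 else F (fl, i, j))"
  proof (cases "v = ([], [])")
    case False
    then have "card (twins v) = 1" by (auto simp: vx)
    moreover have "(\<Sum>w\<in>twins v. F (vclass b h w)) = (\<Sum>w\<in>twins v. F (fl, i, j))"
      using twins_twins(5)[OF v] c by (intro sum.cong) auto
    ultimately show ?thesis using False by (auto simp: vx ij)
  qed (auto simp: vx ij)
  show ?thesis unfolding split K P T c class_nbr_sum_def by simp
qed

lemma vclass_cases:
  assumes v: "v \<in> layer_verts h m" and c: "vclass b h v = (fl, i, j)"
  obtains "i = 0" "j < h" "fl = []" | "i = 0" "j = h" "fl = []" | "0 < i" "i \<le> h" "j = h - i" "b \<longrightarrow> length fl = i" "\<not> b \<longrightarrow> fl = []"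
    | "h < i" "i \<le> h + m" "j = 0" "b \<longrightarrow> length fl = h" "\<not> b \<longrightarrow> fl = []"
proof -
  obtain xs cs where vx: "v = (xs, cs)" by (cases v)
  have ij: "i = length xs" "j = length cs" "fl = (if b then flags h (xs, cs) else [])" using c by (auto simp: vx)
  have "(i = 0 \<and> j < h \<and> fl = []) \<or> (i = 0 \<and> j = h \<and> fl = []) \<or> (0 < i \<and> i \<le> h \<and> j = h - i \<and> (b \<longrightarrow> length fl = i) \<and> (\<not> b \<longrightarrow> fl = []))
    \<or> (h < i \<and> i \<le> h + m \<and> j = 0 \<and> (b \<longrightarrow> length fl = h) \<and> (\<not> b \<longrightarrow> fl = []))"
    using v unfolding vx ij by (cases xs) (auto simp: layer_verts_def)
  then show ?thesis using that by blast
qed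

lemma deg_class: "v \<in> layer_verts h m \<Longrightarrow> FW.deg v = class_nbr_sum b h m (\<lambda>_. 1) (vclass b h v)"
  using nbr_sum_class[of v "\<lambda>_. 1"] by (simp add: FW.deg_def)

lemma deg_le_23: assumes v: "v \<in> layer_verts h m" shows "FW.deg v \<le> 23"
proof -
  obtain fl i j where c: "vclass b h v = (fl, i, j)" by (metis prod.exhaust)
  show ?thesis unfolding deg_class[OF v] c by (simp add: class_nbr_sum_def)
qed

lemma equitable_vclass:
  assumes f: "\<And>x y. x \<in> layer_verts h m \<Longrightarrow> y \<in> layer_verts h m \<Longrightarrow> vclass b h x = vclass b h y \<Longrightarrow> f x = f y"
    and xy: "x \<in> layer_verts h m" "y \<in> layer_verts h m" "vclass b h x = vclass b h y"
  shows "(\<Sum>z\<in>nbrs b h m x. f z) = (\<Sum>z\<in>nbrs b h m y. f z :: real)"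
proof -
  define F where "F c = f (SOME z. z \<in> layer_verts h m \<and> vclass b h z = c)" for c
  have F: "f z = F (vclass b h z)" if "z \<in> layer_verts h m" for z
  proof -
    have "(SOME u. u \<in> layer_verts h m \<and> vclass b h u = vclass b h z) \<in> layer_verts h m \<and>
       vclass b h (SOME u. u \<in> layer_verts h m \<and> vclass b h u = vclass b h z) = vclass b h z"
      using that by (intro someI_ex[of "\<lambda>u. u \<in> layer_verts h m \<and> vclass b h u = vclass b h z"]) blast
    then show ?thesis unfolding F_def by (intro f that) auto
  qed
  have "(\<Sum>z\<in>nbrs b h m x. f z) = (\<Sum>z\<in>nbrs b h m x. F (vclass b h z))"
    by (rule sum.cong[OF refl F[OF FW.nbr_in_V[OF xy(1)]]])
  also have "\<dots> = (\<Sum>z\<in>nbrs b h m y. F (vclass b h z))"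
    by (simp only: nbr_sum_class xy)
  also have "\<dots> = (\<Sum>z\<in>nbrs b h m y. f z)"
    by (rule sum.cong[OF refl F[OF FW.nbr_in_V[OF xy(2)], symmetric]])
  finally show ?thesis .
qed

text \<open>
  In the biased graph, flipping the letter at one position together with the symbol that replaces it
  is a symmetry, and so is any permutation of symbols that respects the parity and the favoured half. This
  is why letters and further details of the symbols do not occur in the classes.
\<close>
lemma rooted_walk_layers: "rooted_walk (layer_verts h m) (nbrs b h m) (vclass b h) ([], []) 23 height"
proof
  show "([], []) \<in> layer_verts h m" by (simp add: layer_verts_def)
next
  fix f x y assume "\<And>x y. x \<in> layer_verts h m \<Longrightarrow> y \<in> layer_verts h m \<Longrightarrow> vclass b h x = vclass b h y \<Longrightarrow> f x = (f y :: real)"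
    "x \<in> layer_verts h m" "y \<in> layer_verts h m" "vclass b h x = vclass b h y"
  then show "(\<Sum>z\<in>nbrs b h m x. f z) = (\<Sum>z\<in>nbrs b h m y. f z)" by (rule equitable_vclass)
next
  fix x :: vertex assume "x \<in> layer_verts h m" "vclass b h x = vclass b h ([], [])"
  then show "x = ([], [])" by (cases x) auto
next
  fix x assume x: "x \<in> layer_verts h m" "x \<noteq> ([], [])"
  obtain y where y: "y \<in> twins x" using twin_exists[OF x(2)] by blast
  have "y \<in> nbrs b h m x" using y by (simp only: nbrs_def Un_iff simp_thms)
  then show "\<exists>y\<in>nbrs b h m x. vclass b h y = vclass b h x" using twins_twins(5)[OF x(1) y] by (rule bexI[rotated])
  show "\<exists>y\<in>nbrs b h m x. height y < height x"
    using parent_exists[OF x] parents_kids(3)[OF x(1)] unfolding nbrs_def by blast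
next
  fix x assume "x \<in> layer_verts h m"
  then show "FW.deg x \<le> 23" by (rule deg_le_23)
qed

end

section \<open>Sizes and test functions\<close>

lemma geometric_20_le: "(\<Sum>i\<le>n. 20 ^ i) \<le> (2 * 20 ^ n :: nat)"
  by (induction n) auto

lemma geometric_2_le: "(\<Sum>i\<le>n. 2 ^ i) \<le> (2 * 2 ^ n :: nat)"
  by (induction n) auto

definition words :: "nat \<Rightarrow> nat list set" where
  "words n = {w. set w \<subseteq> {..<20} \<and> length w = n}"

lemma finite_words [simp]: "finite (words n)"
  unfolding words_def by (rule finite_lists_length_eq) simp

lemma card_words: "card (words n) = 20 ^ n"
  unfolding words_def by (simp add: card_lists_length_eq)

lemma card_words_le: "card {xs. set xs \<subseteq> {..<20::nat} \<and> length xs \<le> n} \<le> 2 * 20 ^ n"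
  using geometric_20_le[of n] by (simp add: card_lists_length_le)

lemma card_bools_le: "card {cs :: bool list. set cs \<subseteq> UNIV \<and> length cs \<le> n} \<le> 2 * 2 ^ n"
  using geometric_2_le[of n] by (subst card_lists_length_le) auto

lemma sum_words_prod:
  "(\<Sum>w\<in>words n. prod_list (map f w)) = (\<Sum>x<20. f x) ^ n" for f :: "nat \<Rightarrow> real"
proof (induction n)
  case 0
  have "words 0 = {[]}" by (auto simp: words_def)
  then show ?case by simp
next
  case (Suc n)
  have "words (Suc n) = (\<lambda>(x, w). x # w) ` ({..<20} \<times> words n)"
    by (force simp: words_def length_Suc_conv image_iff)
  then have "(\<Sum>w\<in>words (Suc n). prod_list (map f w)) = (\<Sum>(x, w)\<in>{..<20} \<times> words n. f x * prod_list (map f w))"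
    by (simp add: sum.reindex inj_on_def case_prod_beta)
  also have "\<dots> = (\<Sum>x<20. \<Sum>w\<in>words n. f x * prod_list (map f w))"
    by (rule sum.cartesian_product[symmetric])
  also have "\<dots> = (\<Sum>x<20. f x) * (\<Sum>w\<in>words n. prod_list (map f w))"
    by (rule sum_product[symmetric])
  finally show ?case using Suc by simp
qed

text \<open>
  The two values make the product of weights slightly superharmonic for the biased walk, whose
  outward steps choose favoured symbols twice as often: \<open>10 * (9 / 10) + 5 * (23 / 20) < 15\<close>,
  with a margin that makes up for the inward steps. On the other hand the mean of the inverse weights
  over a uniform symbol is less than 1, so that most words have a large product.
\<close>
definition weight :: "bool \<Rightarrow> real" where "weight s = (if s then 9 / 10 else 23 / 20)"

text \<open>
  Inside a trap the potential decreases a little towards the leaves. This makes it superharmonic at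
  the root of the trap, and harmonic further inside, where the differences decay
  by the factor 20 per level. It can fail to be superharmonic only at the leaves.
\<close>
fun potential :: "nat \<Rightarrow> bool list \<times> nat \<times> nat \<Rightarrow> real" where
  "potential h (fl, i, j) = prod_list (map weight fl) * (18 / 19 + (1 / 20) ^ (i - h) / 19)"

text \<open>
  The factors are the numbers of outward edges in the middle part of the biased graph and in the traps, so that the flow
  of this gradient is preserved where a vertex has one inward edge.
\<close>
fun slope :: "nat \<Rightarrow> nat \<Rightarrow> real" where
  "slope h 0 = 1"
| "slope h (Suc k) = slope h k / (if Suc k < h then 15 else 20)"

text \<open>
  It vanishes at the centre, between the binary tree and the middle part. Outwards it
  increases with the given slope. Half of the last value of the slope is subtracted throughout: this
  makes the function strictly superharmonic, also at the leaves.
\<close>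
fun barrier :: "nat \<Rightarrow> nat \<Rightarrow> bool list \<times> nat \<times> nat \<Rightarrow> real" where
  "barrier h m (fl, i, j) =
     (if i = 0 then if j < h then (3 / 2) ^ (h - j) else 0
      else (\<Sum>k<i. slope h k - slope h (h + m - 1) / 2))"

lemma weight_pos: "weight s > 0" by (simp add: weight_def)

lemma prod_weight_pos: "prod_list (map weight fl) > 0"
  by (induction fl) (auto simp: weight_pos)

lemma prod_weight_le: "prod_list (map weight fl) \<le> (23 / 20) ^ length fl"
proof (induction fl)
  case (Cons s fl)
  have "weight s \<le> 23 / 20" by (simp add: weight_def)
  then have "weight s * prod_list (map weight fl) \<le> 23 / 20 * (23 / 20) ^ length fl"
    using Cons prod_weight_pos[of fl] weight_pos[of s] by (intro mult_mono) (auto simp: less_imp_le)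
  then show ?case by simp
qed simp

lemma slope_pos: "slope h k > 0"
  by (induction k) auto

lemma slope_antimono: "k \<le> l \<Longrightarrow> slope h l \<le> slope h k"
proof (induction l rule: dec_induct)
  case (step l)
  then show ?case using slope_pos[of h l] by (auto simp: field_simps)
qed simp

lemma slope_le: "slope h k \<le> (1 / 2) ^ k"
proof (induction k)
  case (Suc k)
  then show ?case using slope_pos[of h k] by (auto simp: field_simps)
qed simp

lemma slope_end:
  assumes "h \<ge> 1" shows "slope h (h + m - 1) = 1 / (15 ^ (h - 1) * 20 ^ m)"
proof -
  have 1: "slope h k = 1 / 15 ^ k" if "k < h" for k
    using that by (induction k) auto
  have "slope h (h - 1 + j) = 1 / (15 ^ (h - 1) * 20 ^ j)" for j
  proof (induction j)
    case (Suc j)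
    have "\<not> Suc (h - 1 + j) < h" by simp
    then show ?case using Suc by simp
  qed (use 1[of "h - 1"] assms in simp)
  from this[of m] show ?thesis using assms by simp
qed

context
  fixes b :: bool and h m :: nat
  assumes h: "h \<ge> 1" and m: "m \<ge> 1"
begin

interpretation RW: rooted_walk "layer_verts h m" "nbrs b h m" "vclass b h" "([], [])" 23 height
  by (rule rooted_walk_layers[OF h m])

lemma card_layer_ge: "20 ^ (h + m) \<le> card (layer_verts h m)"
proof -
  have "(\<lambda>w. (w, [])) ` words (h + m) \<subseteq> layer_verts h m"
    using h by (auto simp: words_def layer_verts_def)
  then have "card ((\<lambda>w. (w, [] :: bool list)) ` words (h + m)) \<le> card (layer_verts h m)"
    by (rule card_mono[OF RW.finite_V])
  then show ?thesis by (simp add: card_image inj_on_def card_words)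
qed

lemma card_layer_le: "card (layer_verts h m) \<le> 4 * 2 ^ h * 20 ^ (h + m)"
proof -
  let ?X = "{xs. set xs \<subseteq> {..<20::nat} \<and> length xs \<le> h + m}" and ?C = "{cs :: bool list. set cs \<subseteq> UNIV \<and> length cs \<le> h}"
  have "card (layer_verts h m) \<le> card (?X \<times> ?C)"
    by (intro card_mono finite_cartesian_product finite_lists_length_le) (auto simp: layer_verts_def)
  also have "\<dots> = card ?X * card ?C" by (rule card_cartesian_product)
  also have "\<dots> \<le> (2 * 20 ^ (h + m)) * (2 * 2 ^ h)" by (intro mult_mono card_words_le card_bools_le) auto
  finally show ?thesis by (simp add: mult_ac)
qed

lemma vol_ge: "20 ^ (h + m) \<le> RW.vol"
  using card_layer_ge RW.card_le_vol by (metis of_nat_le_iff of_nat_numeral of_nat_power order_trans)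

lemma vol_le_card: "RW.vol \<le> 23 * real (card (layer_verts h m))"
proof -
  have "RW.vol \<le> (\<Sum>x\<in>layer_verts h m. 23)" unfolding RW.vol_def by (intro sum_mono RW.deg_le)
  then show ?thesis by simp
qed

lemma vol_le: "RW.vol \<le> 92 * 40 ^ h * 20 ^ m"
proof -
  have "real (card (layer_verts h m)) \<le> real (4 * 2 ^ h * 20 ^ (h + m))"
    using card_layer_le by (rule of_nat_mono)
  also have "\<dots> = 4 * (2 * 20) ^ h * 20 ^ m" by (simp only: power_add power_mult_distrib of_nat_mult of_nat_power of_nat_numeral mult_ac)
  finally show ?thesis using vol_le_card by simp
qed

lemma height_vclass: "(2 / 3 :: real) ^ height v = (\<lambda>(fl, i, j). (2 / 3) ^ (2 * i + j)) (vclass b h v)"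
  by (cases v) simp

text \<open>
  The extreme case is the binary tree, where the inward, twin and two outward edges give
  \<open>3 / 2 + 1 + 2 * (2 / 3) = 23 / 24 * 4\<close>.
\<close>
lemma decay_drift:
  assumes v: "v \<in> layer_verts h m" and nl: "length (fst v) \<noteq> h + m"
  shows "(\<Sum>w\<in>nbrs b h m v. (2 / 3) ^ height w) \<le> 23 / 24 * (RW.deg v * (2 / 3 :: real) ^ height v)"
proof -
  define U :: "bool list \<times> nat \<times> nat \<Rightarrow> real" where "U = (\<lambda>(fl, i, j). (2 / 3) ^ (2 * i + j))"
  obtain fl i j where c: "vclass b h v = (fl, i, j)" by (metis prod.exhaust)
  have i: "i \<noteq> h + m" using nl c by (cases v) auto
  have "class_nbr_sum b h m U (fl, i, j) \<le> 23 / 24 * (class_nbr_sum b h m (\<lambda>_. 1) (fl, i, j) * U (fl, i, j))"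
  proof (rule vclass_cases[OF h m v c])
    assume 1: "i = 0" "j < h" "fl = []"
    show ?thesis
    proof (cases j)
      case 0
      then show ?thesis using 1 by (simp add: class_nbr_sum_def U_def)
    next
      case (Suc k)
      have "(2 / 3 :: real) ^ k > 0" by simp
      then show ?thesis using 1 Suc by (simp add: class_nbr_sum_def U_def)
    qed
  next
    assume 1: "i = 0" "j = h" "fl = []"
    then obtain k where k: "j = Suc k" using h by (cases j) auto
    have "(2 / 3 :: real) ^ k > 0" by simp
    then show ?thesis using 1 k by (auto simp: class_nbr_sum_def U_def)
  next
    assume 1: "0 < i" "i \<le> h" "j = h - i" "b \<longrightarrow> length fl = i"
    then obtain k where k: "i = Suc k" by (cases i) auto
    show ?thesis
    proof (cases "i = h")
      case True
      define x where "x = (2 / 3 :: real) ^ (2 * k)"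
      have "x > 0" by (simp add: x_def)
      then show ?thesis using 1 k True m by (auto simp: class_nbr_sum_def U_def x_def[symmetric])
    next
      case False
      then have "j \<noteq> 0" using 1(2,3) by simp
      then obtain l where l: "j = Suc l" by (cases j) auto
      define x where "x = (2 / 3 :: real) ^ (2 * k + l)"
      have "x > 0" "i < h" using 1 False by (auto simp: x_def)
      then show ?thesis using k l by (auto simp: class_nbr_sum_def U_def x_def[symmetric])
    qed
  next
    assume 1: "h < i" "i \<le> h + m" "j = 0"
    then obtain k where k: "i = Suc k" by (cases i) auto
    define x where "x = (2 / 3 :: real) ^ (2 * k)"
    have "x > 0" by (simp add: x_def)
    then show ?thesis using 1 k i by (auto simp: class_nbr_sum_def U_def x_def[symmetric])
  qed
  then show ?thesis
    unfolding height_vclass U_def[symmetric] deg_class[OF h m v] c nbr_sum_class[OF h m v] .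
qed

end

section \<open>Mixing from the root\<close>

lemma barrier_le: "i > 0 \<Longrightarrow> barrier h m (fl, i, j) \<le> 2"
proof -
  assume "i > 0"
  then have "barrier h m (fl, i, j) \<le> (\<Sum>k<i. (1 / 2) ^ k)"
    using slope_le[of h] slope_pos[of h "h + m - 1"] by (auto intro!: sum_mono simp: diff_le_eq add_increasing2)
  also have "\<dots> = ((1 / 2) ^ i - 1) / (1 / 2 - 1)" by (rule geometric_sum) simp
  also have "\<dots> \<le> 2" by simp
  finally show ?thesis .
qed

lemma barrier_pos: "0 < i \<Longrightarrow> i \<le> h + m \<Longrightarrow> barrier h m (fl, i, j) > 0"
proof -
  assume i: "0 < i" "i \<le> h + m"
  have "slope h k - slope h (h + m - 1) / 2 > 0" if "k < i" for k
  proof -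
    have "k \<le> h + m - 1" using that i by simp
    from slope_antimono[OF this, of h] slope_pos[of h "h + m - 1"] show ?thesis by linarith
  qed
  then have "(\<Sum>k<i. slope h k - slope h (h + m - 1) / 2) > 0"
    using i by (intro sum_pos) auto
  then show ?thesis using i by simp
qed

context
  fixes b :: bool and h m :: nat
  assumes h: "h \<ge> 1" and m: "m \<ge> 1"
begin

interpretation RW: rooted_walk "layer_verts h m" "nbrs b h m" "vclass b h" "([], [])" 23 height
  by (rule rooted_walk_layers[OF h m])

lemma barrier_super:
  assumes bt: "b" and v: "v \<in> layer_verts h m" and c: "vclass b h v \<noteq> ([], 0, h)"
  shows "(\<Sum>w\<in>nbrs b h m v. barrier h m (vclass b h v) - barrier h m (vclass b h w))
     \<ge> slope h (h + m - 1) / 4 * barrier h m (vclass b h v)"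
proof -
  define e where "e = slope h (h + m - 1)"
  have e: "e > 0" by (simp add: e_def slope_pos)
  have e20: "e \<le> 1 / 20"
  proof -
    have "(20::real) ^ 1 \<le> 20 ^ m" using m by (intro power_increasing) auto
    moreover have "(1::real) \<le> 15 ^ (h - 1)" by simp
    ultimately have "1 * (20::real) ^ 1 \<le> 15 ^ (h - 1) * 20 ^ m" by (intro mult_mono) auto
    then show ?thesis unfolding e_def slope_end[OF h] by (simp add: field_simps)
  qed
  obtain fl i j where f: "vclass b h v = (fl, i, j)" by (metis prod.exhaust)
  define W where "W = barrier h m"
  have "(\<Sum>w\<in>nbrs b h m v. W (vclass b h v) - W (vclass b h w))
     = class_nbr_sum b h m (\<lambda>_. 1) (fl, i, j) * W (fl, i, j) - class_nbr_sum b h m W (fl, i, j)"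
    using nbr_sum_class[OF h m v, where b = b and F = W] deg_class[OF h m v, where b = b]
    by (simp add: sum_subtractf RW.deg_def f)
  also have "\<dots> \<ge> e / 4 * W (fl, i, j)"
  proof (rule vclass_cases[OF h m v f])
    assume 1: "i = 0" "j < h" "fl = []"
    define w where "w = W (fl, i, j)"
    have w: "w = (3 / 2) ^ (h - j)" using 1 by (simp add: w_def W_def)
    then have wp: "w > 0" by simp
    obtain d where d: "h - j = Suc d" using 1(2) by (metis Suc_diff_Suc)
    have up: "W ([], 0, j + 1) \<le> 2 / 3 * w"
    proof -
      have "h - (j + 1) = d" using d by simp
      moreover have "w = (3 / 2) * (3 / 2) ^ d" unfolding w d by simp
      ultimately show ?thesis using wp by (simp add: W_def)
    qed
    have down: "W ([], 0, j - 1) = 3 / 2 * w" if "j > 0"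
    proof -
      have "h - (j - 1) = Suc (h - j)" "j - 1 < h" using that 1(2) by auto
      then show ?thesis unfolding w by (simp add: W_def)
    qed
    have ew: "e / 4 * w \<le> 1 / 80 * w" using e20 wp by (intro mult_right_mono) auto
    have eq: "class_nbr_sum b h m (\<lambda>_. 1) (fl, i, j) * W (fl, i, j) - class_nbr_sum b h m W (fl, i, j)
       = (if j = 0 then 2 * w - 2 * W ([], 0, j + 1)
          else 3 * w - 2 * W ([], 0, j + 1) - W ([], 0, j - 1))"
      using 1 by (simp add: class_nbr_sum_def w_def)
    have "e / 4 * w \<le> class_nbr_sum b h m (\<lambda>_. 1) (fl, i, j) * W (fl, i, j) - class_nbr_sum b h m W (fl, i, j)"
    proof (cases "j = 0")
      case True
      then show ?thesis unfolding eq if_P[OF True] using up ew wp by linarith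
    next
      case False
      then show ?thesis unfolding eq if_not_P[OF False] using up down ew wp by linarith
    qed
    then show ?thesis by (simp add: w_def)
  next
    assume "i = 0" "j = h" "fl = []"
    then show ?thesis using c f by simp
  next
    assume 1: "0 < i" "i \<le> h" "j = h - i"
    then obtain k where k: "i = Suc k" by (cases i) auto
    define w where "w = W (fl, i, j)"
    define u :: real where "u = (if \<not> hd fl then 1 else 2)"
    have prev: "W (fl', k, Suc j) = w - (slope h k - e / 2)" for fl'
    proof (cases "k = 0")
      case True
      then show ?thesis using 1 k by (simp add: w_def W_def e_def)
    next
      case False
      then show ?thesis by (simp add: w_def W_def k e_def)
    qed
    have nxt: "W (fl', Suc i, j') = w + (slope h i - e / 2)" for fl' j'
      using 1 by (simp add: w_def W_def k e_def)
    define d :: real where "d = (if i < h then 15 else 20)"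
    have fd: "d * slope h i = slope h k" by (simp add: d_def k)
    have inc: "slope h k \<ge> e" unfolding e_def using 1 k m by (intro slope_antimono) auto
    have "e / 4 * w \<le> e / 4 * 2" unfolding w_def W_def using e barrier_le[of i h m fl j] 1 by (intro mult_left_mono) auto
    moreover have "u * (slope h k - e / 2) \<ge> 1 * (slope h k - e / 2)"
      using inc e by (intro mult_right_mono) (auto simp: u_def)
    moreover have "d * e / 2 \<ge> 2 * e / 2" using e by (auto simp: d_def)
    moreover have "class_nbr_sum b h m (\<lambda>_. 1) (fl, i, j) * W (fl, i, j) - class_nbr_sum b h m W (fl, i, j)
       = u * (slope h k - e / 2) - d * (slope h i - e / 2)"
    proof -
      have prev': "W (fl', i - Suc 0, Suc j) = w - (slope h k - e / 2)" for fl' using prev by (simp add: k)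
      have w': "W (fl, i, j) = w" by (simp add: w_def)
      show ?thesis
      proof (cases "i < h")
        case True
        have "class_nbr_sum b h m (\<lambda>_. 1) (fl, i, j) * W (fl, i, j) - class_nbr_sum b h m W (fl, i, j)
          = (16 + u) * w - (15 * (w + (slope h i - e / 2)) + u * (w - (slope h k - e / 2)) + w)"
          using True 1(1) bt by (simp add: class_nbr_sum_def u_def prev' w' nxt)
        then show ?thesis using True by (simp add: d_def algebra_simps)
      next
        case False
        then have ih: "h = i" using 1 by simp
        have "class_nbr_sum b h m (\<lambda>_. 1) (fl, i, j) * W (fl, i, j) - class_nbr_sum b h m W (fl, i, j)
          = (21 + u) * w - (20 * (w + (slope h i - e / 2)) + u * (w - (slope h k - e / 2)) + w)"
          using 1(1) bt m by (simp add: class_nbr_sum_def u_def prev' w' nxt ih)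
        then show ?thesis using False by (simp add: d_def algebra_simps)
      qed
    qed
    ultimately have "e / 4 * w \<le> class_nbr_sum b h m (\<lambda>_. 1) (fl, i, j) * W (fl, i, j) - class_nbr_sum b h m W (fl, i, j)"
    proof -
      assume a: "e / 4 * w \<le> e / 4 * 2" "u * (slope h k - e / 2) \<ge> 1 * (slope h k - e / 2)" "d * e / 2 \<ge> 2 * e / 2"
        and eq: "class_nbr_sum b h m (\<lambda>_. 1) (fl, i, j) * W (fl, i, j) - class_nbr_sum b h m W (fl, i, j)
          = u * (slope h k - e / 2) - d * (slope h i - e / 2)"
      have "d * (slope h i - e / 2) = slope h k - d * e / 2" by (simp add: right_diff_distrib fd)
      moreover have "x \<le> A - B"
        if "x \<le> e / 4 * 2" "A \<ge> 1 * (F - e / 2)" "C \<ge> 2 * e / 2" "B = F - C" for x A B C F :: real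
      proof -
        have "x \<le> e / 2" "A \<ge> F - e / 2" "C \<ge> e" using that(1-3) by simp_all
        then show ?thesis unfolding that(4) by (simp add: field_simps)
      qed
      ultimately show ?thesis unfolding eq using a by blast
    qed
    then show ?thesis by (simp add: w_def)
  next
    assume 1: "h < i" "i \<le> h + m" "j = 0"
    then obtain k where k: "i = Suc k" by (cases i) auto
    have k0: "k > 0" "k \<ge> h" using 1 k h by auto
    define w where "w = W (fl, i, j)"
    have prev: "W (fl', k, j') = w - (slope h k - e / 2)" for fl' j'
      using k0 by (simp add: w_def W_def k e_def)
    have nxt: "W (fl', Suc i, j') = w + (slope h i - e / 2)" for fl' j'
      using 1 by (simp add: w_def W_def k e_def)
    have prev': "W (fl', i - Suc 0, j') = w - (slope h k - e / 2)" for fl' j' using prev by (simp add: k)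
    have w': "W (fl, i, 0) = w" using 1 by (simp add: w_def)
    have fd: "20 * slope h i = slope h k" using k0 by (simp add: k)
    have "e / 4 * w \<le> e / 4 * 2" unfolding w_def W_def using e barrier_le[of i h m fl j] 1 by (intro mult_left_mono) auto
    moreover have "class_nbr_sum b h m (\<lambda>_. 1) (fl, i, j) * W (fl, i, j) - class_nbr_sum b h m W (fl, i, j) \<ge> e / 2"
    proof (cases "i < h + m")
      case True
      have "class_nbr_sum b h m (\<lambda>_. 1) (fl, i, j) * W (fl, i, j) - class_nbr_sum b h m W (fl, i, j)
        = 22 * w - (20 * (w + (slope h i - e / 2)) + (w - (slope h k - e / 2)) + w)"
        using 1(1,3) True by (simp add: class_nbr_sum_def prev' nxt w')
      then show ?thesis using e fd by (simp add: algebra_simps)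
    next
      case False
      then have "k = h + m - 1" using 1 k by simp
      then have fe: "slope h k = e" by (simp add: e_def)
      have "class_nbr_sum b h m (\<lambda>_. 1) (fl, i, j) * W (fl, i, j) - class_nbr_sum b h m W (fl, i, j)
        = 2 * w - ((w - (slope h k - e / 2)) + w)"
        using 1(1,3) False by (simp add: class_nbr_sum_def prev' w')
      then show ?thesis using fe by simp
    qed
    ultimately have "e / 4 * w \<le> class_nbr_sum b h m (\<lambda>_. 1) (fl, i, j) * W (fl, i, j) - class_nbr_sum b h m W (fl, i, j)"
      by simp
    then show ?thesis by (simp add: w_def)
  qed
  finally show ?thesis by (simp add: W_def e_def f)
qed

text \<open>The centre is a single class, as the letters are not part of the class.\<close>
lemma gap_biased:
  assumes bt: "b"
  shows "RW.gap (1 / (4 * 15 ^ (h - 1) * 20 ^ m))"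
proof -
  define Z where "Z = {v. vclass b h v = ([], 0, h)}"
  have pos: "barrier h m (vclass b h x) > 0" if x: "x \<in> layer_verts h m" "x \<notin> Z" for x
  proof -
    obtain fl i j where f: "vclass b h x = (fl, i, j)" by (metis prod.exhaust)
    show ?thesis unfolding f
      by (rule vclass_cases[OF h m x(1) f]) (use x(2) f barrier_pos[of i h m fl j] in \<open>auto simp: Z_def\<close>)
  qed
  have "RW.gap (slope h (h + m - 1) / 4)"
  proof (rule RW.gapI[of "\<lambda>v. barrier h m (vclass b h v)" Z])
    fix x assume x: "x \<in> layer_verts h m"
    show "0 \<le> barrier h m (vclass b h x)" using pos[OF x] by (cases "x \<in> Z") (auto simp: Z_def)
    assume "x \<notin> Z"
    then show "barrier h m (vclass b h x) > 0" using pos x by blast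
    show "(\<Sum>w\<in>nbrs b h m x. barrier h m (vclass b h x) - barrier h m (vclass b h w))
       \<ge> slope h (h + m - 1) / 4 * barrier h m (vclass b h x)"
      using \<open>x \<notin> Z\<close> by (intro barrier_super[OF bt x]) (simp add: Z_def)
  qed (auto simp: Z_def)
  moreover have "slope h (h + m - 1) / 4 = 1 / (4 * 15 ^ (h - 1) * 20 ^ m)" unfolding slope_end[OF h] by simp
  ultimately show ?thesis by (simp only:)
qed

text \<open>Without bias the leaves form a single class.\<close>
lemma gap_unbiased:
  assumes bf: "\<not> b"
  shows "RW.gap (1 / 24)"
proof (rule RW.gapI[of "\<lambda>v. (2 / 3) ^ height v" "{v. length (fst v) = h + m}"])
  fix x assume x: "x \<in> layer_verts h m" "x \<notin> {v. length (fst v) = h + m}"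
  have "1 \<le> RW.deg x" using RW.deg_ge_1 x by blast
  then have "1 / 24 * (1 * (2 / 3 :: real) ^ height x) \<le> 1 / 24 * (RW.deg x * (2 / 3) ^ height x)"
    by (intro mult_left_mono mult_right_mono) auto
  moreover have "(\<Sum>y\<in>nbrs b h m x. (2 / 3 :: real) ^ height x - (2 / 3) ^ height y)
     = RW.deg x * (2 / 3) ^ height x - (\<Sum>y\<in>nbrs b h m x. (2 / 3) ^ height y)"
    by (simp add: sum_subtractf RW.deg_def)
  moreover have "(\<Sum>w\<in>nbrs b h m x. (2 / 3) ^ height w) \<le> 23 / 24 * (RW.deg x * (2 / 3 :: real) ^ height x)"
    using x by (intro decay_drift[OF h m]) auto
  ultimately show "1 / 24 * (2 / 3 :: real) ^ height x \<le> (\<Sum>y\<in>nbrs b h m x. (2 / 3) ^ height x - (2 / 3) ^ height y)"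
    by linarith
next
  fix x y assume "x \<in> layer_verts h m" "x \<in> {v. length (fst v) = h + m}"
    "y \<in> layer_verts h m" "y \<in> {v. length (fst v) = h + m}"
  then show "vclass b h x = vclass b h y" using bf h m by (cases x; cases y) (auto simp: layer_verts_def)
qed auto

lemma leaf_class_heavy:
  assumes v: "v \<in> layer_verts h m" and l: "length (fst v) = h + m"
  shows "20 ^ m \<le> RW.class_deg v"
proof -
  obtain xs where vx: "v = (xs, [])" "length xs = h + m" "set xs \<subseteq> {..<20}"
    using v l h m by (cases v) (auto simp: layer_verts_def)
  have sub: "(\<lambda>ys. (ys @ drop m xs, [])) ` words m \<subseteq> RW.class_of v"
  proof
    fix z assume "z \<in> (\<lambda>ys. (ys @ drop m xs, [] :: bool list)) ` words m"
    then obtain ys where z: "z = (ys @ drop m xs, [])" "set ys \<subseteq> {..<20}" "length ys = m" by (auto simp: words_def)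
    then have "z \<in> layer_verts h m" using vx set_drop_subset[of m xs] by (auto simp: layer_verts_def)
    moreover have "vclass b h z = vclass b h v" using z vx by simp
    ultimately show "z \<in> RW.class_of v" by (simp add: RW.class_of_def)
  qed
  have fin: "finite (RW.class_of v)" using RW.class_of_subset RW.finite_V finite_subset by blast
  have "card ((\<lambda>ys. (ys @ drop m xs, [] :: bool list)) ` words m) \<le> card (RW.class_of v)"
    using sub fin by (rule card_mono[rotated])
  then have "20 ^ m \<le> card (RW.class_of v)" by (simp add: card_image inj_on_def card_words)
  then have "(20::real) ^ m \<le> real (card (RW.class_of v))" by (metis of_nat_le_iff of_nat_numeral of_nat_power)
  also have "\<dots> = (\<Sum>y\<in>RW.class_of v. 1)" by simp
  also have "\<dots> \<le> RW.class_deg v"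
    unfolding RW.class_deg_def by (intro sum_mono RW.deg_ge_1 subsetD[OF RW.class_of_subset])
  finally show ?thesis .
qed

lemma unbiased_mixing_dist:
  assumes bf: "\<not> b"
  shows "mixing_dist p RW.encoded (to_nat (([], []) :: vertex)) t \<le> RW.vol * sqrt ((1 - 1 / 12696) ^ t)"
  using RW.sup_deviation_from_gap[OF gap_unbiased[OF bf], of _ t]
  by (intro RW.mixing_dist_le) simp

text \<open>
  Both smoothing phases take \<open>20 ^ m\<close> steps, a lower bound for the mass of a class of leaves. Thus the factor
  in front is the volume times \<open>(24 + 2) / 20 ^ m\<close>, and \<open>2116 = 4 * 23\<^sup>2\<close>
  comes from the gap and the degrees.
\<close>
lemma biased_mixing_dist:
  assumes bt: "b"
  shows "mixing_dist p RW.encoded (to_nat (([], []) :: vertex)) (2 * 20 ^ m + t)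
    \<le> 2392 * 40 ^ h * sqrt ((1 - 1 / (2116 * 15 ^ (h - 1) * 20 ^ m)) ^ t)"
proof (rule RW.mixing_dist_le)
  fix y assume y: "y \<in> layer_verts h m"
  define \<kappa> :: real where "\<kappa> = 1 / (4 * 15 ^ (h - 1) * 20 ^ m)"
  define q where "q = sqrt ((1 - \<kappa> / 23\<^sup>2) ^ t)"
  have "1 * 1 \<le> (15::real) ^ (h - 1) * 20 ^ m" by (intro mult_mono) auto
  then have k: "0 \<le> \<kappa>" "\<kappa> \<le> 1" by (simp_all add: \<kappa>_def)
  have q: "q \<ge> 0" using RW.contraction_factor[OF k] by (simp add: q_def)
  have dr: "RW.avg (\<lambda>v. (2 / 3) ^ height v) x \<le> (1 - 1 / 24) * (2 / 3) ^ height x"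
    if "x \<in> layer_verts h m" "x \<notin> {v. length (fst v) = h + m}" for x
    using decay_drift[OF h m that(1), of b] that RW.deg_pos[OF that(1)]
    by (simp add: RW.avg_def divide_le_eq mult_ac)
  have "\<bar>RW.vol * RW.law (2 * 20 ^ m + t) y / RW.deg ([], []) - 1\<bar>
      \<le> RW.vol * (1 / (1 / 24 * real (20 ^ m)) + 2 / 20 ^ m) * q"
    unfolding q_def
  proof (rule RW.sup_deviation_after_smoothing[of "\<lambda>v. (2 / 3) ^ height v" "1 / 24" "20 ^ m" "{v. length (fst v) = h + m}"])
    show "RW.class_fun (\<lambda>v. (2 / 3) ^ height v)"
    proof (rule RW.class_funI)
      fix x y assume "vclass b h x = vclass b h y"
      then show "(2 / 3 :: real) ^ height x = (2 / 3) ^ height y" by (simp only: height_vclass[OF h m, where b = b])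
    qed
    show "RW.gap \<kappa>" unfolding \<kappa>_def by (rule gap_biased[OF bt])
  qed (use dr leaf_class_heavy k y in auto)
  also have "RW.vol * (1 / (1 / 24 * real (20 ^ m)) + 2 / 20 ^ m) = RW.vol * (26 / 20 ^ m)"
    by (simp add: add_divide_distrib[symmetric])
  also have "\<dots> \<le> (92 * 40 ^ h * 20 ^ m) * (26 / 20 ^ m)"
    using vol_le[OF h m, of b] by (intro mult_right_mono) auto
  also have "\<dots> = 2392 * 40 ^ h" by simp
  finally have "\<bar>RW.vol * RW.law (2 * 20 ^ m + t) y / RW.deg ([], []) - 1\<bar> \<le> 2392 * 40 ^ h * q"
    using q by (simp add: mult_right_mono)
  then show "\<bar>RW.vol * RW.law (2 * 20 ^ m + t) y / RW.deg ([], []) - 1\<bar>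
     \<le> 2392 * 40 ^ h * sqrt ((1 - 1 / (2116 * 15 ^ (h - 1) * 20 ^ m)) ^ t)"
    by (simp add: q_def \<kappa>_def mult_ac)
qed

text \<open>
  The error comes from the leaves. It is at most the largest product of weights times the last
  difference of the potential inside the trap.
\<close>
lemma potential_drift:
  assumes bt: "b" and v: "v \<in> layer_verts h m"
  shows "RW.avg (\<lambda>w. potential h (vclass b h w)) v \<le> potential h (vclass b h v) + (23 / 20) ^ h / 20 ^ m"
proof -
  define \<Phi> where "\<Phi> = potential h"
  define E :: real where "E = (23 / 20) ^ h / 20 ^ m"
  have E: "E > 0" by (simp add: E_def)
  obtain fl i j where f: "vclass b h v = (fl, i, j)" by (metis prod.exhaust)
  define P where "P = prod_list (map weight fl)"
  have P: "P > 0" by (simp add: P_def prod_weight_pos)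
  have "class_nbr_sum b h m \<Phi> (fl, i, j) \<le> class_nbr_sum b h m (\<lambda>_. 1) (fl, i, j) * (\<Phi> (fl, i, j) + E)"
  proof (rule vclass_cases[OF h m v f])
    assume "i = 0" "j < h" "fl = []"
    then show ?thesis using E by (simp add: class_nbr_sum_def \<Phi>_def)
  next
    assume "i = 0" "j = h" "fl = []"
    then show ?thesis using E h bt by (simp add: class_nbr_sum_def \<Phi>_def weight_def)
  next
    assume 1: "0 < i" "i \<le> h" "j = h - i" "b \<longrightarrow> length fl = i"
    then obtain s gl where s: "fl = s # gl" using bt by (cases fl) auto
    define R where "R = prod_list (map weight gl)"
    have R: "R > 0" by (simp add: R_def prod_weight_pos)
    have PR: "P = weight s * R" by (simp add: P_def R_def s)
    show ?thesis
    proof (cases "i < h")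
      case True
      then show ?thesis using 1 E bt R s
        by (cases s) (simp_all add: class_nbr_sum_def \<Phi>_def weight_def R_def[symmetric])
    next
      case False
      then show ?thesis using 1 E bt R s m
        by (cases s) (simp_all add: class_nbr_sum_def \<Phi>_def weight_def R_def[symmetric])
    qed
  next
    assume 1: "h < i" "i \<le> h + m" "j = 0" "b \<longrightarrow> length fl = h"
    define k where "k = i - h - 1"
    have k: "i - h = Suc k" "i - 1 - h = k" "Suc i - h = Suc (Suc k)" "i - Suc h = k" using 1 by (auto simp: k_def)
    define x where "x = (1 / 20 :: real) ^ k"
    have x: "x > 0" by (simp add: x_def)
    show ?thesis
    proof (cases "i < h + m")
      case True
      then show ?thesis using 1 E
        by (simp add: class_nbr_sum_def \<Phi>_def k P_def[symmetric] x_def[symmetric] algebra_simps)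
    next
      case False
      then have "k = m - 1" using 1 by (simp add: k_def)
      then have "x = 20 / 20 ^ m" unfolding x_def using m by (cases m) (auto simp: power_divide)
      moreover have "P \<le> (23 / 20) ^ h" unfolding P_def using prod_weight_le[of fl] 1 bt by simp
      ultimately have "P * x \<le> 20 * E" unfolding E_def by (simp add: divide_right_mono)
      then show ?thesis using 1(1,3) False E
        by (simp add: class_nbr_sum_def \<Phi>_def k P_def[symmetric] x_def[symmetric] algebra_simps)
    qed
  qed
  then show ?thesis using RW.deg_pos[OF v] nbr_sum_class[OF h m v, where b = b and F = \<Phi>] deg_class[OF h m v, where b = b]
    by (simp add: RW.avg_def \<Phi>_def E_def f divide_le_eq mult_ac)
qed

text \<open>
  Markov's inequality for the inverse product under uniform symbols. The constant is the sum of
  the inverse weights, \<open>10 / (9 / 10) + 10 / (23 / 20)\<close>, which is less than 20.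
\<close>
lemma bad_words: "real (card {w \<in> words h. prod_list (map (weight \<circ> favoured) w) < 10}) \<le> 10 * (4100 / 207) ^ h"
proof -
  let ?W = "\<lambda>w. prod_list (map (weight \<circ> favoured) w)"
  have pos: "?W w > 0" for w using prod_weight_pos[of "map favoured w"] by (simp add: comp_def)
  have inv: "prod_list (map (\<lambda>x. 1 / weight (favoured x)) w) = 1 / ?W w" for w
    by (induction w) auto
  have "real (card {w \<in> words h. ?W w < 10}) = (\<Sum>w\<in>{w \<in> words h. ?W w < 10}. 1)" by simp
  also have "\<dots> \<le> (\<Sum>w\<in>{w \<in> words h. ?W w < 10}. 10 * (1 / ?W w))"
    using pos by (intro sum_mono) (auto simp: field_simps less_imp_le)
  also have "\<dots> \<le> (\<Sum>w\<in>words h. 10 * (1 / ?W w))"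
    using pos by (intro sum_mono2) (auto simp: less_imp_le)
  also have "\<dots> = 10 * (\<Sum>w\<in>words h. prod_list (map (\<lambda>x. 1 / weight (favoured x)) w))"
    by (simp add: inv sum_distrib_left)
  also have "\<dots> = 10 * (\<Sum>x<20. 1 / weight (favoured x)) ^ h" by (simp add: sum_words_prod)
  also have "(\<Sum>x<20. 1 / weight (favoured x)) = 4100 / 207"
    unfolding symbol_set by (simp add: weight_def favoured_def)
  finally show ?thesis .
qed

text \<open>The typical traps for the stationary distribution, which the biased walk avoids.\<close>
definition trapped :: "vertex set" where
  "trapped = {v \<in> layer_verts h m. h \<le> length (fst v) \<and> 10 \<le> prod_list (map weight (flags h v))}"

lemma card_untrapped:
  "real (card (layer_verts h m - trapped)) \<le> 4 * 40 ^ h + 20 * 20 ^ m * (4100 / 207) ^ h"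
proof -
  let ?X = "\<lambda>n. {xs. set xs \<subseteq> {..<20::nat} \<and> length xs \<le> n}" and ?C = "{cs :: bool list. set cs \<subseteq> UNIV \<and> length cs \<le> h}"
  let ?bad = "{w \<in> words h. prod_list (map (weight \<circ> favoured) w) < 10}"
  let ?B = "(\<lambda>(ys, w). (ys @ w, [] :: bool list)) ` (?X m \<times> ?bad)"
  have fin: "finite (?X n)" "finite ?C" for n
    by (rule finite_lists_length_le, simp)+
  have finb: "finite ?B" using fin by (intro finite_imageI finite_cartesian_product) auto
  have "layer_verts h m - trapped \<subseteq> ?X h \<times> ?C \<union> ?B"
  proof
    fix v assume v: "v \<in> layer_verts h m - trapped"
    obtain xs cs where vx: "v = (xs, cs)" by (cases v)
    show "v \<in> ?X h \<times> ?C \<union> ?B"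
    proof (cases "length xs \<ge> h")
      case False
      then show ?thesis using v by (auto simp: vx layer_verts_def)
    next
      case True
      define ys w where "ys = take (length xs - h) xs" and "w = drop (length xs - h) xs"
      have xs: "xs = ys @ w" "length w = h" "length ys \<le> m" "set xs \<subseteq> {..<20}" "cs = []"
        using v True h by (auto simp: vx layer_verts_def ys_def w_def)
      have "prod_list (map (weight \<circ> favoured) w) < 10"
        using v True by (auto simp: trapped_def vx w_def)
      then have "w \<in> ?bad" using xs by (auto simp: words_def)
      moreover have "ys \<in> ?X m" using xs by auto
      ultimately show ?thesis using xs(1,5) vx by (intro UnI2 image_eqI[of _ _ "(ys, w)"]) auto
    qed
  qed
  then have "card (layer_verts h m - trapped) \<le> card (?X h \<times> ?C \<union> ?B)"
    using fin finb by (intro card_mono finite_UnI finite_cartesian_product) auto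
  also have "\<dots> \<le> card (?X h \<times> ?C) + card ?B" by (rule card_Un_le)
  also have "\<dots> \<le> card (?X h \<times> ?C) + card (?X m \<times> ?bad)"
    using fin by (intro add_left_mono card_image_le finite_cartesian_product) auto
  also have "\<dots> = card (?X h) * card ?C + card (?X m) * card ?bad"
    by (simp only: card_cartesian_product)
  finally have "card (layer_verts h m - trapped) \<le> card (?X h) * card ?C + card (?X m) * card ?bad" .
  also have "\<dots> \<le> (2 * 20 ^ h) * (2 * 2 ^ h) + (2 * 20 ^ m) * card ?bad"
    by (intro add_mono mult_mono card_words_le card_bools_le) auto
  finally have "real (card (layer_verts h m - trapped)) \<le> real ((2 * 20 ^ h) * (2 * 2 ^ h) + (2 * 20 ^ m) * card ?bad)"
    by (rule of_nat_mono)
  also have "\<dots> = 4 * (20 * 2) ^ h + 2 * 20 ^ m * real (card ?bad)"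
    by (simp only: power_mult_distrib) simp
  also have "\<dots> \<le> 4 * (20 * 2) ^ h + 2 * 20 ^ m * (10 * (4100 / 207) ^ h)"
    using bad_words by (intro add_left_mono mult_left_mono) auto
  finally show ?thesis by (simp add: mult_ac)
qed

lemma biased_mixing_dist_ge:
  assumes bt: "b" and t: "real t * (23 / 20) ^ h \<le> 20 ^ m"
    and small: "23 * (4 * 40 ^ h + 20 * 20 ^ m * (4100 / 207) ^ h) \<le> 1 / 4 * (20 :: real) ^ (h + m)"
  shows "1 / 2 \<le> mixing_dist p RW.encoded (to_nat (([], []) :: vertex)) t"
proof -
  let ?\<Phi> = "\<lambda>v. potential h (vclass b h v)"
  have \<Phi>_nonneg: "?\<Phi> v \<ge> 0" for v
    by (cases v) (simp add: less_imp_le[OF prod_weight_pos])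
  have "indicator trapped v \<le> 19 / 180 * ?\<Phi> v" for v
  proof (cases "v \<in> trapped")
    case True
    obtain xs cs where vx: "v = (xs, cs)" by (cases v)
    define P where "P = prod_list (map weight (flags h v))"
    have P: "P \<ge> 10" using True by (simp add: trapped_def P_def)
    have "180 / 19 \<le> P * (18 / 19)" using P by simp
    also have "\<dots> \<le> P * (18 / 19 + (1 / 20) ^ (length xs - h) / 19)" using P by (intro mult_left_mono) auto
    also have "\<dots> = ?\<Phi> v" using bt by (simp add: vx P_def)
    finally show ?thesis using True by (simp add: indicator_def)
  qed (use \<Phi>_nonneg in simp)
  then have "(RW.avg ^^ t) (indicator trapped) ([], []) \<le> (RW.avg ^^ t) (\<lambda>v. 19 / 180 * ?\<Phi> v) ([], [])"
    by (intro RW.funpow_mono RW.root)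
  also have "(RW.avg ^^ t) (\<lambda>v. 19 / 180 * ?\<Phi> v) ([], [])
     \<le> 19 / 180 * ?\<Phi> ([], []) + real t * (19 / 180 * ((23 / 20) ^ h / 20 ^ m))"
  proof (rule RW.funpow_mono_const[OF _ RW.root])
    fix x assume "x \<in> layer_verts h m"
    then have "RW.avg ?\<Phi> x \<le> ?\<Phi> x + (23 / 20) ^ h / 20 ^ m" by (rule potential_drift[OF bt])
    then show "RW.avg (\<lambda>v. 19 / 180 * ?\<Phi> v) x \<le> 19 / 180 * ?\<Phi> x + 19 / 180 * ((23 / 20) ^ h / 20 ^ m)"
      unfolding RW.avg_scale by simp
  qed
  also have "\<dots> = 19 / 180 * (1 + real t * (23 / 20) ^ h / 20 ^ m)" using bt by (simp add: algebra_simps)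
  also have "\<dots> \<le> 19 / 180 * (1 + 1)" using t by (intro mult_left_mono add_left_mono) (auto simp: divide_le_eq)
  finally have a: "(RW.avg ^^ t) (indicator trapped) ([], []) \<le> 1 / 4" by simp
  have "real (card (layer_verts h m - trapped)) * 23 \<le> 23 * (4 * 40 ^ h + 20 * 20 ^ m * (4100 / 207) ^ h)"
    using card_untrapped by simp
  also have "\<dots> \<le> 1 / 4 * 20 ^ (h + m)" by (rule small)
  also have "\<dots> \<le> 1 / 4 * RW.vol" using vol_ge[OF h m, of b] by simp
  finally have "1 - 1 / 4 - 1 / 4 \<le> mixing_dist p RW.encoded (to_nat (([], []) :: vertex)) t"
    using a by (intro RW.mixing_dist_ge[of trapped]) (auto simp: trapped_def)
  then show ?thesis by simp
qed

end

text \<open>An edge that is missing in the biased graph is replaced by a step to the twin of its outer end and a second step.\<close>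
lemma quasi_isometry_layers:
  assumes h: "h \<ge> 1" and m: "m \<ge> 1"
  defines "G \<equiv> encode_graph (layer_verts h m) (nbrs False h m)"
    and "G' \<equiv> encode_graph (layer_verts h m) (nbrs True h m)"
  shows "quasi_isometry 2 0 (pverts G) (graph_dist G) (pverts G') (graph_dist G') id"
proof -
  interpret U: rooted_walk "layer_verts h m" "nbrs False h m" "vclass False h" "([], [])" 23 height
    by (rule rooted_walk_layers[OF h m])
  interpret B: rooted_walk "layer_verts h m" "nbrs True h m" "vclass True h" "([], [])" 23 height
    by (rule rooted_walk_layers[OF h m])
  have sub: "nbrs True h m v \<subseteq> nbrs False h m v" for v
  proof -
    have l: "linked True x c \<Longrightarrow> linked False x c" for x c by (simp add: linked_def)
    obtain xs cs where v: "v = (xs, cs)" by (cases v)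
    have "kids True h m v \<subseteq> kids False h m v"
      unfolding v kids.simps using l by (simp, blast)
    moreover have "parents True h v \<subseteq> parents False h v"
      unfolding v parents.simps using l by (simp, blast)
    ultimately show ?thesis unfolding nbrs_def by blast
  qed
  have step: "\<exists>p. pre_digraph.awalk (with_proj G') (to_nat x) p (to_nat y) \<and> length p \<le> 2"
    if x: "x \<in> layer_verts h m" and y: "y \<in> nbrs False h m x" for x y
  proof (cases "y \<in> nbrs True h m x")
    case True
    then have "B.PG.awalk (to_nat x) [(to_nat x, to_nat y)] (to_nat y)"
      using x B.nbr_in_V[OF x True] by (auto simp: B.PG.awalk_simps B.arc_iff)
    then show ?thesis unfolding G'_def by (intro exI[of _ "[(to_nat x, to_nat y)]"]) auto
  next
    case False
    have "\<exists>z. z \<in> nbrs True h m x \<and> y \<in> nbrs True h m z"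
    proof -
      have kid: "\<exists>z. z \<in> twins k \<and> z \<in> kids True h m p"
        if p: "p \<in> layer_verts h m" and k: "k \<in> kids False h m p" "k \<notin> kids True h m p" for p k
      proof -
        obtain xs cs where px: "p = (xs, cs)" by (cases p)
        have c: "\<not> (xs = [] \<and> length cs < h)" "length xs < h"
          using k by (auto simp: px split: if_splits)
        have kids: "kids b' h m p = (\<lambda>x. (x # xs, tl cs)) ` {x. x < 20 \<and> linked b' x (hd cs)}" for b'
          by (simp only: px kids.simps if_not_P[OF c(1)] if_P[OF c(2)])
        obtain s where s: "k = (s # xs, tl cs)" "s < 20" "\<not> linked True s (hd cs)"
          using k unfolding kids by blast
        then have "linked True (flip s) (hd cs)" "flip s < 20"
          by (auto simp: linked_def odd_flip flip_less)
        then have "(flip s # xs, tl cs) \<in> kids True h m p" unfolding kids by blast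
        then show ?thesis using s by auto
      qed
      have "y \<in> kids False h m x \<or> y \<in> parents False h x"
        using y False unfolding nbrs_def by blast
      then show ?thesis
      proof
        assume k: "y \<in> kids False h m x"
        moreover have "y \<notin> kids True h m x" using False unfolding nbrs_def by blast
        ultimately obtain z where z: "z \<in> twins y" "z \<in> kids True h m x"
          using kid[OF x k] by blast
        have "y \<in> twins z" by (rule twins_twins(2)[OF h m U.nbr_in_V[OF x y] z(1)])
        then show ?thesis using z unfolding nbrs_def by blast
      next
        assume p: "y \<in> parents False h x"
        have yV: "y \<in> layer_verts h m" using U.nbr_in_V[OF x y] .
        have k: "x \<in> kids False h m y" using parents_kids(2)[OF h m x p] .
        have nk: "x \<notin> kids True h m y"
          using kids_parents(2)[OF h m yV, where b = True] False unfolding nbrs_def by blast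
        obtain z where z: "z \<in> twins x" "z \<in> kids True h m y" using kid[OF yV k nk] by blast
        then have "y \<in> parents True h z" using kids_parents(2)[OF h m yV] by blast
        then show ?thesis using z unfolding nbrs_def by blast
      qed
    qed
    then obtain z where z: "z \<in> nbrs True h m x" "y \<in> nbrs True h m z" by blast
    have "B.PG.awalk (to_nat x) [(to_nat x, to_nat z), (to_nat z, to_nat y)] (to_nat y)"
      using x z B.nbr_in_V[OF x z(1)] B.nbr_in_V[OF B.nbr_in_V[OF x z(1)] z(2)]
      by (auto simp: B.PG.awalk_simps B.arc_iff)
    then show ?thesis unfolding G'_def by (intro exI[of _ "[(to_nat x, to_nat z), (to_nat z, to_nat y)]"]) auto
  qed
  show ?thesis
  proof (rule quasi_isometry_of_subgraph)
    show "pair_graph G" "Digraph_Component.connected (with_proj G)"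
      unfolding G_def by (rule U.pair_graph_encode, rule U.connected_encode)
    show "pair_graph G'" "Digraph_Component.connected (with_proj G')"
      unfolding G'_def by (rule B.pair_graph_encode, rule B.connected_encode)
    show "pverts G = pverts G'" by (simp add: G_def G'_def)
    show "parcs G' \<subseteq> parcs G" using sub by (fastforce simp: G_def G'_def encode_graph_def)
    fix u v assume "(u, v) \<in> parcs G"
    then obtain x y where "u = to_nat x" "v = to_nat y" "x \<in> layer_verts h m" "y \<in> nbrs False h m x"
      by (auto simp: G_def encode_graph_def)
    then show "\<exists>p. pre_digraph.awalk (with_proj G') u p v \<and> length p \<le> 2" using step by blast
  qed
qed

section \<open>The theorem\<close>

lemma decay_timeE:
  fixes a K \<epsilon> :: real
  assumes a: "0 < a" "a \<le> 1" and e: "0 < \<epsilon>" "\<epsilon> \<le> K"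
  obtains t where "K * sqrt ((1 - a) ^ t) < \<epsilon>" "real t \<le> 2 / a * ln (K / \<epsilon>) + 1"
proof -
  define x where "x = 2 / a * ln (K / \<epsilon>)"
  define t where "t = nat \<lfloor>x\<rfloor> + 1"
  have x: "x \<ge> 0" using a e by (simp add: x_def)
  have t: "x < real t" "real t \<le> x + 1" using x unfolding t_def by linarith+
  have "(1 - a) ^ t \<le> exp (- a) ^ t" using a exp_ge_add_one_self[of "- a"] by (intro power_mono) auto
  also have "\<dots> = (exp (- (a * real t / 2)))\<^sup>2" by (simp add: exp_of_nat_mult[symmetric] exp_double[symmetric] mult_ac)
  finally have "sqrt ((1 - a) ^ t) \<le> exp (- (a * real t / 2))" by (intro real_le_lsqrt) auto
  also have "\<dots> < exp (- ln (K / \<epsilon>))" using t(1) a by (simp add: x_def field_simps)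
  also have "\<dots> = \<epsilon> / K" using e by (simp add: exp_minus)
  finally have "K * sqrt ((1 - a) ^ t) < K * (\<epsilon> / K)" using e by (intro mult_strict_left_mono) auto
  then show ?thesis using that[of t] t(2) e by (simp add: x_def)
qed

definition layer_graph :: "bool \<Rightarrow> nat \<Rightarrow> nat \<Rightarrow> nat pair_pre_digraph" where
  "layer_graph b h m = encode_graph (layer_verts h m) (nbrs b h m)"

definition layer_root :: nat where "layer_root = to_nat (([], []) :: vertex)"

definition layer_size :: "nat \<Rightarrow> nat \<Rightarrow> real" where
  "layer_size h m = real (card (pverts (layer_graph False h m)))"

context
  fixes h m :: nat
  assumes h: "h \<ge> 1" and m: "m \<ge> 1"
begin

interpretation U: rooted_walk "layer_verts h m" "nbrs False h m" "vclass False h" "([], [])" 23 height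
  by (rule rooted_walk_layers[OF h m])

interpretation B: rooted_walk "layer_verts h m" "nbrs True h m" "vclass True h" "([], [])" 23 height
  by (rule rooted_walk_layers[OF h m])

lemma layer_size_eq: "layer_size h m = real (card (layer_verts h m))"
  by (simp add: layer_size_def layer_graph_def card_image)

lemma layer_size_ge: "20 ^ (h + m) \<le> layer_size h m"
  using card_layer_ge[OF h m] unfolding layer_size_eq by (metis of_nat_le_iff of_nat_numeral of_nat_power)

lemma layer_size_le: "layer_size h m \<le> 4 * 40 ^ h * 20 ^ m"
proof -
  have "layer_size h m \<le> real (4 * 2 ^ h * 20 ^ (h + m))"
    unfolding layer_size_eq using card_layer_le[OF h m] by (rule of_nat_mono)
  also have "\<dots> = 4 * (2 * 20) ^ h * 20 ^ m"
    by (simp only: power_add power_mult_distrib of_nat_mult of_nat_power of_nat_numeral mult_ac)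
  finally show ?thesis by simp
qed

lemma layer_size_gt_1: "layer_size h m > 1"
proof -
  have "(1::real) < 20 ^ (h + m)" using h by (intro one_less_power) auto
  then show ?thesis using layer_size_ge by (rule order_less_le_trans)
qed

lemma layer_graph_rooted: "finite_connected_rooted_graph (layer_graph b h m) layer_root"
  using U.finite_connected_rooted_encode B.finite_connected_rooted_encode
  by (cases b) (simp_all add: layer_graph_def layer_root_def)

lemma layer_graph_degree:
  assumes "v \<in> pverts (layer_graph b h m)"
  shows "vertex_degree (layer_graph b h m) v \<le> 23"
proof -
  obtain x where x: "x \<in> layer_verts h m" "v = to_nat x" using assms by (auto simp: layer_graph_def)
  have "real (vertex_degree (layer_graph b h m) v) \<le> 23"
    using U.vertex_degree_encode[OF x(1)] B.vertex_degree_encode[OF x(1)] U.deg_le[OF x(1)] B.deg_le[OF x(1)]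
    by (cases b) (simp_all add: layer_graph_def x)
  then show ?thesis by simp
qed

text \<open>The constants are \<open>12696 = 24 * 23\<^sup>2\<close>, from the gap and the degrees, and \<open>50785 = 4 * 12696 + 1\<close>.\<close>
lemma unbiased_upper:
  assumes e: "0 < \<epsilon>" "\<epsilon> < 1 / 2" and n: "ln (23 / \<epsilon>) \<le> ln (layer_size h m)" "1 \<le> ln (layer_size h m)"
  shows "mixing_time p \<epsilon> (layer_graph False h m) layer_root \<le> ereal (50785 * ln (layer_size h m))"
proof -
  define K where "K = 23 * layer_size h m"
  have Kp: "K > 0" "\<epsilon> \<le> K" using layer_size_gt_1 e by (auto simp: K_def)
  obtain t where t: "K * sqrt ((1 - 1 / 12696) ^ t) < \<epsilon>" "real t \<le> 2 / (1 / 12696) * ln (K / \<epsilon>) + 1"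
    using decay_timeE[of "1 / 12696" \<epsilon> K] e Kp by auto
  have "mixing_dist p (layer_graph False h m) layer_root t \<le> U.vol * sqrt ((1 - 1 / 12696) ^ t)"
    unfolding layer_graph_def layer_root_def by (rule unbiased_mixing_dist[OF h m]) simp
  also have "\<dots> \<le> K * sqrt ((1 - 1 / 12696) ^ t)"
    using vol_le_card[OF h m, where b = False] by (intro mult_right_mono) (auto simp: K_def layer_size_eq)
  also have "\<dots> < \<epsilon>" by (rule t)
  finally have "mixing_time p \<epsilon> (layer_graph False h m) layer_root \<le> ereal (real t)" by (rule mixing_time_le)
  also have "K / \<epsilon> = (23 / \<epsilon>) * layer_size h m" by (simp add: K_def)
  then have "ln (K / \<epsilon>) = ln (23 / \<epsilon>) + ln (layer_size h m)"
    using e layer_size_gt_1 ln_mult_pos[of "23 / \<epsilon>" "layer_size h m"] by simp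
  then have "real t \<le> 50785 * ln (layer_size h m)" using t(2) n by simp
  finally show ?thesis by simp
qed

lemma unbiased_lower:
  assumes e: "\<epsilon> \<le> 1 / 2" and n: "2 * ln 46 \<le> ln (layer_size h m)"
  shows "ereal (1 / (2 * ln 23) * ln (layer_size h m)) \<le> mixing_time p \<epsilon> (layer_graph False h m) layer_root"
proof (rule le_mixing_time)
  fix t assume "real t < 1 / (2 * ln 23) * ln (layer_size h m)"
  then have "real t * ln 23 \<le> ln (layer_size h m) / 2" by (simp add: field_simps)
  then have "ln 46 + real t * ln 23 \<le> ln (layer_size h m)" using n by simp
  then have "exp (ln 46 + real t * ln 23) \<le> exp (ln (layer_size h m))" by simp
  moreover have "exp (ln 46 + real t * ln 23) = 2 * 23 ^ Suc t"
    by (simp add: exp_add exp_of_nat_mult)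
  ultimately have "2 * 23 ^ Suc t \<le> layer_size h m" using layer_size_gt_1 by simp
  also have "\<dots> \<le> U.vol" using U.card_le_vol by (simp add: layer_size_eq)
  finally have "1 / 2 \<le> mixing_dist p (layer_graph False h m) layer_root t"
    unfolding layer_graph_def layer_root_def by (rule U.mixing_dist_ge_support)
  then show "\<epsilon> \<le> mixing_dist p (layer_graph False h m) layer_root t" using e by simp
qed

lemma biased_lower:
  assumes e: "\<epsilon> \<le> 1 / 2"
    and small: "23 * (4 * 40 ^ h + 20 * 20 ^ m * (4100 / 207) ^ h) \<le> 1 / 4 * (20 :: real) ^ (h + m)"
  shows "ereal (20 ^ m / (23 / 20) ^ h) \<le> mixing_time p \<epsilon> (layer_graph True h m) layer_root"
proof (rule le_mixing_time)
  fix t assume "real t < 20 ^ m / (23 / 20) ^ h"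
  then have "real t * (23 / 20) ^ h \<le> 20 ^ m" by (simp add: field_simps)
  then have "1 / 2 \<le> mixing_dist p (layer_graph True h m) layer_root t"
    unfolding layer_graph_def layer_root_def using small by (intro biased_mixing_dist_ge[OF h m]) auto
  then show "\<epsilon> \<le> mixing_dist p (layer_graph True h m) layer_root t" using e by simp
qed

lemma biased_upper:
  assumes e: "0 < \<epsilon>" "\<epsilon> < 1 / 2"
  shows "mixing_time p \<epsilon> (layer_graph True h m) layer_root
    \<le> ereal (20 ^ m * (3 + 4232 * 15 ^ h * (ln (2392 / \<epsilon>) + real h * ln 40)))"
proof -
  define K where "K = 2392 * (40::real) ^ h"
  define A where "A = 2116 * (15::real) ^ (h - 1) * 20 ^ m"
  have "(1::real) \<le> 40 ^ h" by simp
  then have Kp: "K > 0" "\<epsilon> \<le> K" unfolding K_def using e by linarith+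
  have "1 * 1 \<le> (15::real) ^ (h - 1) * 20 ^ m" by (intro mult_mono) auto
  then have A: "A \<ge> 1" by (simp add: A_def)
  obtain t where t: "K * sqrt ((1 - 1 / A) ^ t) < \<epsilon>" "real t \<le> 2 / (1 / A) * ln (K / \<epsilon>) + 1"
    using decay_timeE[of "1 / A" \<epsilon> K] e Kp A by auto
  have "mixing_dist p (layer_graph True h m) layer_root (2 * 20 ^ m + t) \<le> K * sqrt ((1 - 1 / A) ^ t)"
    unfolding layer_graph_def layer_root_def K_def A_def by (rule biased_mixing_dist[OF h m]) simp
  also have "\<dots> < \<epsilon>" by (rule t)
  finally have "mixing_time p \<epsilon> (layer_graph True h m) layer_root \<le> ereal (real (2 * 20 ^ m + t))"
    by (rule mixing_time_le)
  also have "real (2 * 20 ^ m + t) \<le> 20 ^ m * (3 + 4232 * 15 ^ h * (ln (2392 / \<epsilon>) + real h * ln 40))"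
  proof -
    have "K / \<epsilon> = (2392 / \<epsilon>) * 40 ^ h" by (simp add: K_def)
    then have l: "ln (K / \<epsilon>) = ln (2392 / \<epsilon>) + real h * ln 40"
      using e ln_mult_pos[of "2392 / \<epsilon>" "40 ^ h"] by (simp add: ln_realpow)
    have l0: "ln (K / \<epsilon>) \<ge> 0" using Kp e by simp
    have "(15::real) ^ (h - 1) \<le> 15 ^ h" by (intro power_increasing) auto
    then have "A \<le> 2116 * 15 ^ h * 20 ^ m" by (simp add: A_def)
    then have "2 * A * ln (K / \<epsilon>) \<le> 2 * (2116 * 15 ^ h * 20 ^ m) * ln (K / \<epsilon>)"
      using l0 by (intro mult_right_mono mult_left_mono) auto
    moreover have "real t \<le> 2 * A * ln (K / \<epsilon>) + 1" using t(2) by simp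
    moreover have "(1::real) \<le> 20 ^ m" by simp
    ultimately have "2 * 20 ^ m + real t \<le> 2 * 20 ^ m + 20 ^ m + 2 * (2116 * 15 ^ h * 20 ^ m) * ln (K / \<epsilon>)"
      by linarith
    then show ?thesis by (simp add: l algebra_simps)
  qed
  finally show ?thesis by simp
qed

end

lemma eventually_trap_dominates:
  "\<forall>\<^sub>F h in sequentially. \<forall>m\<ge>h. 23 * (4 * 40 ^ h + 20 * 20 ^ m * (4100 / 207) ^ h) \<le> 1 / 4 * (20 :: real) ^ (h + m)"
proof -
  have "\<forall>\<^sub>F h in sequentially. 92 * 2 ^ h \<le> 1 / 8 * (20::real) ^ h" by real_asymp
  moreover have "\<forall>\<^sub>F h in sequentially. 460 * (4100 / 207) ^ h \<le> 1 / 8 * (20::real) ^ h" by real_asymp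
  ultimately show ?thesis
  proof eventually_elim
    case (elim h)
    show ?case
    proof (intro allI impI)
      fix m assume "h \<le> m"
      then have "(20::real) ^ h \<le> 20 ^ m" by (intro power_increasing) auto
      then have "92 * 2 ^ h \<le> 1 / 8 * (20::real) ^ m" using elim(1) by linarith
      then have "92 * 2 ^ h * 20 ^ h \<le> 1 / 8 * (20::real) ^ m * 20 ^ h" by (intro mult_right_mono) auto
      moreover have "460 * (4100 / 207) ^ h * 20 ^ m \<le> 1 / 8 * (20::real) ^ h * 20 ^ m" using elim(2) by (intro mult_right_mono) auto
      moreover have "(40::real) ^ h = 2 ^ h * 20 ^ h" by (simp flip: power_mult_distrib)
      moreover have "23 * (4 * 40 ^ h + 20 * 20 ^ m * (4100 / 207) ^ h) = 92 * (40::real) ^ h + 460 * (4100 / 207) ^ h * 20 ^ m"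
        by simp
      moreover have "1 / 4 * (20 :: real) ^ (h + m) = 1 / 8 * 20 ^ m * 20 ^ h + 1 / 8 * 20 ^ h * 20 ^ m"
        by (simp add: power_add)
      ultimately show "23 * (4 * 40 ^ h + 20 * 20 ^ m * (4100 / 207) ^ h) \<le> 1 / 4 * (20 :: real) ^ (h + m)"
        by (simp only: mult.assoc)
    qed
  qed
qed

lemma biased_ratio_at_top:
  "filterlim (\<lambda>h. 20 ^ h / (3 + 4232 * 15 ^ h * (c + real h * ln 40))) at_top sequentially" if "c > 0"
  using that by real_asymp

theorem mainTheorem1:
  fixes g :: "nat \<Rightarrow> real"
  assumes "\<And>m. g m > 0"
    and "filterlim g at_top sequentially"
  shows "\<exists>(D::nat) (a::real) (b::real)
      (G :: nat \<Rightarrow> nat pair_pre_digraph) (r :: nat \<Rightarrow> nat)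
      (G' :: nat \<Rightarrow> nat pair_pre_digraph) (r' :: nat \<Rightarrow> nat).
    a \<ge> 1 \<and> b \<ge> 0 \<and>
    (\<forall>n\<ge>1. finite_connected_rooted_graph (G n) (r n) \<and>
            finite_connected_rooted_graph (G' n) (r' n)) \<and>
    (\<forall>n\<ge>1. (\<forall>v\<in>pverts (G n). vertex_degree (G n) v \<le> D) \<and>
            (\<forall>v\<in>pverts (G' n). vertex_degree (G' n) v \<le> D)) \<and>
    filterlim (\<lambda>n. card (pverts (G n))) at_top sequentially \<and>
    (\<forall>n\<ge>1. \<exists>\<psi>.
        quasi_isometry a b (pverts (G n)) (graph_dist (G n)) (pverts (G' n)) (graph_dist (G' n)) \<psi> \<and>
        \<psi> (r n) = r' n) \<and>
    (\<forall>\<epsilon>\<in>{0<..<1/2}. \<forall>p. \<exists>(c::real) (C::real). 0 < c \<and> c \<le> C \<and>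
        (\<forall>\<^sub>F n in sequentially.
           ereal (c * ln (real (card (pverts (G n))))) \<le> mixing_time p \<epsilon> (G n) (r n) \<and>
           mixing_time p \<epsilon> (G n) (r n) \<le> ereal (C * ln (real (card (pverts (G n))))))) \<and>
    (\<forall>\<epsilon>\<in>{0<..<1/2}. \<forall>p.
        ((\<lambda>n. ereal (real (card (pverts (G n)))) / mixing_time p \<epsilon> (G' n) (r' n)) \<longlongrightarrow> \<infinity>) sequentially \<and>
        (\<forall>\<^sub>F n in sequentially.
           ereal (real (card (pverts (G n)))) / mixing_time p \<epsilon> (G' n) (r' n)
             \<le> ereal (g (card (pverts (G n))))))"
proof -
  have "\<exists>m. m \<ge> max h 1 \<and> (\<forall>N\<ge>20 ^ m. 4 * 46 ^ h \<le> g N)" for h :: nat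
  proof -
    have "\<forall>\<^sub>F N in sequentially. 4 * 46 ^ h \<le> g N"
      using assms(2) by (simp add: filterlim_at_top)
    then obtain N0 where N0: "\<And>N. N \<ge> N0 \<Longrightarrow> 4 * 46 ^ h \<le> g N" by (auto simp: eventually_sequentially)
    define m where "m = max (max h 1) N0"
    have "m < 20 ^ m" by (rule less_exp[THEN order_less_le_trans]) (simp add: power_mono)
    then have "N \<ge> N0" if "N \<ge> 20 ^ m" for N using that by (simp add: m_def)
    then show ?thesis using N0 by (intro exI[of _ m]) (auto simp: m_def)
  qed
  then obtain d where d: "\<And>h. d h \<ge> max h 1" "\<And>h N. N \<ge> 20 ^ d h \<Longrightarrow> 4 * 46 ^ h \<le> g N"
    by metis
  define G where "G = (\<lambda>n. layer_graph False n (d n))"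
  define G' where "G' = (\<lambda>n. layer_graph True n (d n))"
  define N where "N = (\<lambda>n. card (pverts (G n)))"
  have d1: "d n \<ge> 1" for n using d(1)[of n] by simp
  have N_size: "real (N n) = layer_size n (d n)" for n by (simp add: N_def G_def layer_size_def)
  have N_ge: "20 ^ (n + d n) \<le> N n" if "n \<ge> 1" for n
    using layer_size_ge[OF that d1[of n]] unfolding N_size[symmetric]
    by (metis of_nat_le_iff of_nat_numeral of_nat_power)
  have N_top: "filterlim N at_top sequentially"
  proof (rule filterlim_at_top_mono[OF filterlim_ident])
    show "\<forall>\<^sub>F n in sequentially. n \<le> N n"
      using eventually_ge_at_top[of 1]
    proof eventually_elim
      case (elim n)
      have "n < 2 ^ n" by (rule less_exp)
      also have "\<dots> \<le> 20 ^ n" by (simp add: power_mono)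
      also have "\<dots> \<le> 20 ^ (n + d n)" by (intro power_increasing) auto
      finally show ?case using N_ge[OF elim] by simp
    qed
  qed
  have lnN: "\<forall>\<^sub>F n in sequentially. x \<le> ln (real (N n))" for x
  proof -
    have "filterlim (\<lambda>n. ln (real (N n))) at_top sequentially"
      by (intro filterlim_compose[OF ln_at_top] filterlim_compose[OF filterlim_real_sequentially] N_top)
    then show ?thesis by (simp add: filterlim_at_top)
  qed
  show ?thesis
  proof (rule exI[of _ 23], rule exI[of _ 2], rule exI[of _ 0], rule exI[of _ G], rule exI[of _ "\<lambda>_. layer_root"],
      rule exI[of _ G'], rule exI[of _ "\<lambda>_. layer_root"], intro conjI)
    show "(2::real) \<ge> 1" "(0::real) \<ge> 0" by auto
    show "\<forall>n\<ge>1. finite_connected_rooted_graph (G n) layer_root \<and> finite_connected_rooted_graph (G' n) layer_root"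
      using layer_graph_rooted d1 by (simp add: G_def G'_def)
    show "\<forall>n\<ge>1. (\<forall>v\<in>pverts (G n). vertex_degree (G n) v \<le> 23) \<and> (\<forall>v\<in>pverts (G' n). vertex_degree (G' n) v \<le> 23)"
      using layer_graph_degree d1 by (simp add: G_def G'_def)
    show "filterlim (\<lambda>n. card (pverts (G n))) at_top sequentially" using N_top by (simp add: N_def)
    show "\<forall>n\<ge>1. \<exists>\<psi>. quasi_isometry 2 0 (pverts (G n)) (graph_dist (G n)) (pverts (G' n)) (graph_dist (G' n)) \<psi> \<and>
        \<psi> layer_root = layer_root"
    proof (intro allI impI)
      fix n :: nat assume "n \<ge> 1"
      from quasi_isometry_layers[OF this d1[of n]]
      show "\<exists>\<psi>. quasi_isometry 2 0 (pverts (G n)) (graph_dist (G n)) (pverts (G' n)) (graph_dist (G' n)) \<psi> \<and>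
        \<psi> layer_root = layer_root"
        by (intro exI[of _ id]) (simp add: G_def G'_def layer_graph_def)
    qed
    show "\<forall>\<epsilon>\<in>{0<..<1/2}. \<forall>p. \<exists>(c::real) (C::real). 0 < c \<and> c \<le> C \<and>
        (\<forall>\<^sub>F n in sequentially.
           ereal (c * ln (real (card (pverts (G n))))) \<le> mixing_time p \<epsilon> (G n) layer_root \<and>
           mixing_time p \<epsilon> (G n) layer_root \<le> ereal (C * ln (real (card (pverts (G n))))))"
    proof (intro ballI allI)
      fix \<epsilon> :: real and p assume e: "\<epsilon> \<in> {0<..<1/2}"
      have "ln 23 \<ge> (1::real)" using exp_le by (subst ln_ge_iff) auto
      then have c: "0 < 1 / (2 * ln 23 :: real)" "1 / (2 * ln 23) \<le> (50785::real)"
        by (auto simp: divide_le_eq)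
      have "\<forall>\<^sub>F n in sequentially. n \<ge> 1 \<and> ln (23 / \<epsilon>) \<le> ln (real (N n)) \<and> 1 \<le> ln (real (N n)) \<and> 2 * ln 46 \<le> ln (real (N n))"
        by (intro eventually_conj eventually_ge_at_top lnN)
      then have "\<forall>\<^sub>F n in sequentially.
           ereal (1 / (2 * ln 23) * ln (real (N n))) \<le> mixing_time p \<epsilon> (G n) layer_root \<and>
           mixing_time p \<epsilon> (G n) layer_root \<le> ereal (50785 * ln (real (N n)))"
      proof eventually_elim
        case (elim n)
        then show ?case
          using unbiased_lower[of n "d n" \<epsilon> p] unbiased_upper[of n "d n" \<epsilon> p] d1[of n] e
          unfolding N_size G_def by simp
      qed
      then show "\<exists>(c::real) (C::real). 0 < c \<and> c \<le> C \<and>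
        (\<forall>\<^sub>F n in sequentially.
           ereal (c * ln (real (card (pverts (G n))))) \<le> mixing_time p \<epsilon> (G n) layer_root \<and>
           mixing_time p \<epsilon> (G n) layer_root \<le> ereal (C * ln (real (card (pverts (G n))))))"
        using c unfolding N_def by blast
    qed
    show "\<forall>\<epsilon>\<in>{0<..<1/2}. \<forall>p.
        ((\<lambda>n. ereal (real (card (pverts (G n)))) / mixing_time p \<epsilon> (G' n) layer_root) \<longlongrightarrow> \<infinity>) sequentially \<and>
        (\<forall>\<^sub>F n in sequentially.
           ereal (real (card (pverts (G n)))) / mixing_time p \<epsilon> (G' n) layer_root
             \<le> ereal (g (card (pverts (G n)))))"
    proof (intro ballI allI)
      fix \<epsilon> :: real and p assume e: "\<epsilon> \<in> {0<..<1/2}"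
      define F where "F n = 20 ^ n / (3 + 4232 * 15 ^ n * (ln (2392 / \<epsilon>) + real n * ln 40))" for n
      have c: "ln (2392 / \<epsilon>) > 0" using e by simp
      have both: "\<forall>\<^sub>F n in sequentially. ereal (F n) \<le> ereal (real (N n)) / mixing_time p \<epsilon> (G' n) layer_root \<and>
          ereal (real (N n)) / mixing_time p \<epsilon> (G' n) layer_root \<le> ereal (g (N n))"
        using eventually_trap_dominates eventually_ge_at_top[of 1]
      proof eventually_elim
        case (elim n)
        define L where "L = 20 ^ d n / (23 / 20 :: real) ^ n"
        define R where "R = 3 + 4232 * 15 ^ n * (ln (2392 / \<epsilon>) + real n * ln 40)"
        have R: "R > 0" unfolding R_def using c by (intro add_pos_nonneg mult_nonneg_nonneg) auto
        have lo: "ereal L \<le> mixing_time p \<epsilon> (G' n) layer_root"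
          unfolding L_def G'_def using elim d(1)[of n] e by (intro biased_lower) auto
        have up: "mixing_time p \<epsilon> (G' n) layer_root \<le> ereal (20 ^ d n * R)"
          unfolding R_def G'_def using elim d1 e by (intro biased_upper) auto
        obtain \<tau> where \<tau>: "mixing_time p \<epsilon> (G' n) layer_root = ereal \<tau>" "L \<le> \<tau>" "\<tau> \<le> 20 ^ d n * R"
          using lo up by (cases "mixing_time p \<epsilon> (G' n) layer_root") auto
        have L: "L > 0" by (simp add: L_def)
        have "F n = 20 ^ (n + d n) / (20 ^ d n * R)" by (simp add: F_def R_def power_add)
        also have "\<dots> \<le> real (N n) / (20 ^ d n * R)"
          using layer_size_ge[OF elim(2) d1[of n]] R by (intro divide_right_mono) (auto simp: N_size)
        also have "\<dots> \<le> real (N n) / \<tau>"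
          using \<tau> L R by (intro divide_left_mono) auto
        finally have 1: "F n \<le> real (N n) / \<tau>" .
        have "real (N n) / \<tau> \<le> real (N n) / L" using \<tau> L by (intro divide_left_mono) auto
        also have "\<dots> \<le> 4 * 40 ^ n * 20 ^ d n / L"
          using layer_size_le[OF elim(2) d1[of n]] L by (intro divide_right_mono) (auto simp: N_size)
        also have "\<dots> = 4 * (40 ^ n * (23 / 20) ^ n)" by (simp add: L_def)
        also have "\<dots> = 4 * 46 ^ n" by (simp flip: power_mult_distrib)
        also have "\<dots> \<le> g (N n)"
        proof (rule d(2))
          have "20 ^ d n \<le> (20::nat) ^ (n + d n)" by (intro power_increasing) auto
          then show "20 ^ d n \<le> N n" using N_ge[OF elim(2)] by (rule order_trans)
        qed
        finally have 2: "real (N n) / \<tau> \<le> g (N n)" .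
        show ?case using 1 2 \<tau> L by simp
      qed
      have "filterlim F at_top sequentially"
        unfolding F_def using biased_ratio_at_top[OF c] .
      then have "((\<lambda>n. ereal (F n)) \<longlongrightarrow> \<infinity>) sequentially" by (simp add: tendsto_PInfty_eq_at_top)
      then have "((\<lambda>n. ereal (real (N n)) / mixing_time p \<epsilon> (G' n) layer_root) \<longlongrightarrow> \<infinity>) sequentially"
        by (rule tendsto_sandwich[OF _ _ _ tendsto_const, rotated 2]) (use both in \<open>auto elim: eventually_mono\<close>)
      moreover have "\<forall>\<^sub>F n in sequentially.
          ereal (real (N n)) / mixing_time p \<epsilon> (G' n) layer_root \<le> ereal (g (N n))"
        using both by (rule eventually_mono) simp
      ultimately show "((\<lambda>n. ereal (real (card (pverts (G n)))) / mixing_time p \<epsilon> (G' n) layer_root) \<longlongrightarrow> \<infinity>) sequentially \<and>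
        (\<forall>\<^sub>F n in sequentially.
           ereal (real (card (pverts (G n)))) / mixing_time p \<epsilon> (G' n) layer_root
             \<le> ereal (g (card (pverts (G n)))))"
        unfolding N_def by blast
    qed
  qed
qed

end
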